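(* Let $X$ be a super-reflexive Banach space that has an equivalent norm with modulus of smoothness of power type $2$. Let $U\subset X$ be an open quasiconvex set, $\omega\in\mathcal M$, and $f\in C^{1,\omega}(U)$. Then $f$ can be extended to a function $F\in C^{1,\omega}(X)$.
   Context: All normed linear spaces are real and $Df$ denotes the Fréchet derivative. $\mathcal M$ is the set of all functions $\omega\colon[0,+\infty)\to[0,+\infty)$ that are non-decreasing and continuous at $0$ with $\omega(0)=0$. For an open subset $U$ of a normed linear space and $\omega\in\mathcal M$, $C^{1,\omega}(U)$ is the set of all Fréchet differentiable $f\colon U\to\mathbb R$ for which there is $C\ge0$ with $\|Df(x)-Df(y)\|\le C\omega(\|x-y\|)$ for all $x,y\in U$. A metric space $(Z,\rho)$ is $c$-quasiconvex ($c\ge1$) if for each $x,y\in Z$ there is a continuous rectifiable curve $\gamma\colon[0,1]\to Z$ with $\gamma(0)=x$, $\gamma(1)=y$ and length (variation) at most $c\rho(x,y)$; it is quasiconvex if it is $c$-quasiconvex for some $c\ge1$. Subsets of normed spaces carry the norm metric. The modulus of smoothness of a norm $\|\cdot\|$ on $X$ is $\rho(\tau)=\sup\{\frac{\|x+\tau y\|+\|x-\tau y\|}{2}-1 : x,y\in X,\ \|x\|=\|y\|=1\}$, $\tau\ge0$; it is of power type $p>1$ if there is $K>0$ with $\rho(\tau)\le K\tau^p$ for all $\tau\ge0$. A Banach space is super-reflexive if and only if it has an equivalent uniformly smooth norm. *)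

theory Defs
  imports "HOL-Analysis.Analysis"
begin

(* A second norm on the type 'a is a function N; the type-class norm is the norm given with X. *)

definition is_norm :: "('a::real_vector \<Rightarrow> real) \<Rightarrow> bool" where
  "is_norm N \<longleftrightarrow>
     (\<forall>x. N x = 0 \<longleftrightarrow> x = 0) \<and>
     (\<forall>a x. N (a *\<^sub>R x) = \<bar>a\<bar> * N x) \<and>
     (\<forall>x y. N (x + y) \<le> N x + N y)"

definition equivalent_norm :: "('a::real_normed_vector \<Rightarrow> real) \<Rightarrow> bool" where
  "equivalent_norm N \<longleftrightarrow>
     is_norm N \<and> (\<exists>a>0. \<exists>b>0. \<forall>x. a * norm x \<le> N x \<and> N x \<le> b * norm x)"

(* All the numbers in the supremum are non-negative when N is a norm, so inserting 0 only
   matters on the zero space, where the unit sphere is empty and Sup {} is unspecified;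
   see the lemma below. *)
definition modulus_of_smoothness :: "('a::real_vector \<Rightarrow> real) \<Rightarrow> real \<Rightarrow> real" where
  "modulus_of_smoothness N \<tau> =
     Sup (insert 0 {(N (x + \<tau> *\<^sub>R y) + N (x - \<tau> *\<^sub>R y)) / 2 - 1 | x y. N x = 1 \<and> N y = 1})"

lemma modulus_of_smoothness_eq_Sup:
  fixes N :: "'a::real_vector \<Rightarrow> real"
  assumes N: "is_norm N" and nontrivial: "\<exists>x::'a. x \<noteq> 0"
  shows "modulus_of_smoothness N \<tau> =
    Sup {(N (x + \<tau> *\<^sub>R y) + N (x - \<tau> *\<^sub>R y)) / 2 - 1 | x y. N x = 1 \<and> N y = 1}"
    (is "_ = Sup ?A")
proof -
  have zero: "\<And>x. N x = 0 \<longleftrightarrow> x = 0" and scale: "\<And>a x. N (a *\<^sub>R x) = \<bar>a\<bar> * N x"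
    and tri: "\<And>x y. N (x + y) \<le> N x + N y"
    using N by (auto simp: is_norm_def)
  obtain v :: 'a where v: "v \<noteq> 0" using nontrivial by blast
  have "N (inverse \<bar>N v\<bar> *\<^sub>R v) = \<bar>inverse (N v)\<bar> * N v" by (simp add: scale)
  moreover have "N v \<ge> 0" using tri[of v "- v"] scale[of "-1" v] zero[of 0] by simp
  ultimately have u: "N (inverse \<bar>N v\<bar> *\<^sub>R v) = 1" using v zero[of v] by simp
  have nonneg: "0 \<le> r" if "r \<in> ?A" for r
  proof -
    obtain x y where r: "r = (N (x + \<tau> *\<^sub>R y) + N (x - \<tau> *\<^sub>R y)) / 2 - 1" and x: "N x = 1"
      using \<open>r \<in> ?A\<close> by blast
    have "(x + \<tau> *\<^sub>R y) + (x - \<tau> *\<^sub>R y) = 2 *\<^sub>R x" by (simp add: scaleR_2)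
    then show ?thesis
      using tri[of "x + \<tau> *\<^sub>R y" "x - \<tau> *\<^sub>R y"] scale[of 2 x] x r by simp
  qed
  have upper: "r \<le> \<bar>\<tau>\<bar>" if "r \<in> ?A" for r
  proof -
    obtain x y where r: "r = (N (x + \<tau> *\<^sub>R y) + N (x - \<tau> *\<^sub>R y)) / 2 - 1"
      and xy: "N x = 1" "N y = 1"
      using \<open>r \<in> ?A\<close> by blast
    have "N (x + \<tau> *\<^sub>R y) \<le> 1 + \<bar>\<tau>\<bar>" using tri[of x "\<tau> *\<^sub>R y"] scale[of \<tau> y] xy by simp
    moreover have "N (x - \<tau> *\<^sub>R y) \<le> 1 + \<bar>\<tau>\<bar>"
      using tri[of x "(- \<tau>) *\<^sub>R y"] scale[of "- \<tau>" y] xy by simp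
    ultimately show ?thesis unfolding r by argo
  qed
  have bdd: "bdd_above ?A" by (rule bdd_aboveI[OF upper])
  have ne: "?A \<noteq> {}" using u by blast
  then obtain r where r: "r \<in> ?A" by blast
  have "0 \<le> Sup ?A" using cSup_upper[OF r bdd] nonneg[OF r] by linarith
  then show ?thesis
    unfolding modulus_of_smoothness_def using cSup_insert[OF ne bdd, of 0] by (simp add: sup_max)
qed

definition smoothness_power_type :: "('a::real_vector \<Rightarrow> real) \<Rightarrow> real \<Rightarrow> bool" where
  "smoothness_power_type N p \<longleftrightarrow>
     p > 1 \<and> (\<exists>K>0. \<forall>\<tau>\<ge>0. modulus_of_smoothness N \<tau> \<le> K * \<tau> powr p)"

definition uniformly_smooth :: "('a::real_vector \<Rightarrow> real) \<Rightarrow> bool" where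
  "uniformly_smooth N \<longleftrightarrow> ((\<lambda>\<tau>. modulus_of_smoothness N \<tau> / \<tau>) \<longlongrightarrow> 0) (at_right 0)"

(* Super-reflexivity in Enflo's renorming form: James's original definition quantifies over all
   Banach spaces finitely representable in X, which is not possible inside a HOL formula. *)
definition super_reflexive :: "'a::banach itself \<Rightarrow> bool" where
  "super_reflexive _ \<longleftrightarrow> (\<exists>N :: 'a \<Rightarrow> real. equivalent_norm N \<and> uniformly_smooth N)"

(* The class M of moduli; only the values on [0, \<infinity>) are relevant. *)
definition moduli :: "(real \<Rightarrow> real) set" where
  "moduli = {\<omega>. (\<forall>t\<ge>0. \<omega> t \<ge> 0) \<and> mono_on {0..} \<omega> \<and> \<omega> 0 = 0 \<and>
                 continuous (at 0 within {0..}) \<omega>}"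

(* For U open; only the values of f on U are relevant, and onorm is the dual norm. *)
definition C1_omega :: "(real \<Rightarrow> real) \<Rightarrow> 'a::real_normed_vector set \<Rightarrow> ('a \<Rightarrow> real) set" where
  "C1_omega \<omega> U = {f. (\<forall>x\<in>U. f differentiable (at x)) \<and>
     (\<exists>C\<ge>0. \<forall>x\<in>U. \<forall>y\<in>U.
        onorm (\<lambda>h. frechet_derivative f (at x) h - frechet_derivative f (at y) h)
          \<le> C * \<omega> (norm (x - y)))}"

(* Total variation over [0,1]; it is \<infinity> for non-rectifiable curves. *)
definition curve_length :: "(real \<Rightarrow> 'a::metric_space) \<Rightarrow> ereal" where
  "curve_length \<gamma> =
     (SUP ts \<in> {ts. sorted ts \<and> set ts \<subseteq> {0..1}}.
        ereal (\<Sum>i<length ts - 1. dist (\<gamma> (ts ! i)) (\<gamma> (ts ! Suc i))))"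

definition c_quasiconvex :: "real \<Rightarrow> 'a::metric_space set \<Rightarrow> bool" where
  "c_quasiconvex c Z \<longleftrightarrow> c \<ge> 1 \<and>
     (\<forall>x\<in>Z. \<forall>y\<in>Z. \<exists>\<gamma>. path \<gamma> \<and> path_image \<gamma> \<subseteq> Z \<and>
        pathstart \<gamma> = x \<and> pathfinish \<gamma> = y \<and> curve_length \<gamma> \<le> ereal (c * dist x y))"

definition quasiconvex :: "'a::metric_space set \<Rightarrow> bool" where
  "quasiconvex Z \<longleftrightarrow> (\<exists>c. c_quasiconvex c Z)"

end

theory Submission
  imports Defs
begin

text \<open>
  Let \<open>\<omega>\<close> be concave and write \<open>\<theta> t = t * \<omega> t\<close>.  A locally bounded function \<open>F\<close> belongs to
  \<open>C1_omega \<omega> UNIV\<close> if both \<open>F\<close> and \<open>- F\<close> are paraconvex, that is, convex up to the error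
  \<open>C * u * (1 - u) * \<theta> (norm (x - y))\<close> (\<open>paraconvex_both_imp_C1\<close>).  Paraconvexity is a family of inequalities between
  values, so it survives suprema, which derivatives do not.  This turns the extension problem into an
  insertion problem: if \<open>l \<le> g\<close> with \<open>l\<close> and \<open>- g\<close> paraconvex, then the largest paraconvex
  function below \<open>g\<close> is above \<open>l\<close> and its negative is paraconvex too (\<open>paraconvex_insertion\<close>).

  For a first-order jet \<open>(f, G)\<close> on a set \<open>E\<close>, the natural bounds are
  \<open>l x = (SUP y. f y + G y (x - y) - M * \<psi> (x - y))\<close> and
  \<open>g x = (INF y. f y + G y (x - y) + M * \<psi> (x - y))\<close>, with \<open>\<psi>\<close> comparable to \<open>\<theta> (norm x)\<close>.
  The Taylor estimates for the jet say that \<open>l \<le> g\<close> once \<open>M\<close> is large, and \<open>f \<le> l\<close> and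
  \<open>g \<le> f\<close> on \<open>E\<close> are seen by taking \<open>y = x\<close>, so that anything between \<open>l\<close> and \<open>g\<close> extends \<open>f\<close>.
  This needs \<open>- \<psi>\<close> to be paraconvex, and here the geometry of the space enters: for a norm \<open>N\<close> of
  power type 2 the function \<open>- N\<^sup>2\<close> is paraconvex with the modulus \<open>t\<close>
  (\<open>square_semiconcave\<close>), and for concave \<open>\<omega>\<close> the function \<open>\<theta> (N x)\<close> is touched from above
  at each nonzero point by a multiple of \<open>N\<^sup>2\<close> plus a constant, whose coefficient is at most
  \<open>\<omega> (N x) / N x\<close> (\<open>modulus_times_id_norm_semiconcave\<close>).

  Quasiconvexity of \<open>U\<close> is used twice.  Joining points by short chains inside \<open>U\<close> shows that the
  true modulus of continuity of the derivative on \<open>U\<close> is dominated by a concave modulus, itself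
  dominated by a multiple of the given \<open>\<omega>\<close> (\<open>quasiconvex_concave_majorant\<close>); so \<open>\<omega>\<close> may be taken
  concave.  The mean value inequality along such chains gives the Taylor estimate (\<open>quasiconvex_taylor\<close>).
\<close>

section \<open>Concave moduli of continuity\<close>

definition concave_modulus :: "(real \<Rightarrow> real) \<Rightarrow> bool" where
  "concave_modulus \<omega> \<longleftrightarrow> \<omega> \<in> moduli \<and> concave_on {0..} \<omega>"

lemma moduli_nonneg: "\<omega> \<in> moduli \<Longrightarrow> 0 \<le> t \<Longrightarrow> 0 \<le> \<omega> t"
  by (simp add: moduli_def)

lemma moduli_mono: "\<omega> \<in> moduli \<Longrightarrow> 0 \<le> s \<Longrightarrow> s \<le> t \<Longrightarrow> \<omega> s \<le> \<omega> t"
  by (auto simp: moduli_def mono_on_def)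

lemma moduli_zero: "\<omega> \<in> moduli \<Longrightarrow> \<omega> 0 = 0"
  by (simp add: moduli_def)

lemma moduli_small:
  assumes "\<omega> \<in> moduli" "e > 0"
  obtains d where "d > 0" "\<And>t. 0 \<le> t \<Longrightarrow> t < d \<Longrightarrow> \<omega> t < e"
proof -
  have "continuous (at 0 within {0..}) \<omega>" and \<omega>0: "\<omega> 0 = 0"
    using assms(1) by (auto simp: moduli_def)
  then obtain d where d: "d > 0" "\<forall>t\<in>{0..}. dist t 0 < d \<longrightarrow> dist (\<omega> t) (\<omega> 0) < e"
    using assms(2) unfolding continuous_within_eps_delta by metis
  have "\<omega> t < e" if "0 \<le> t" "t < d" for t
    using d(2)[rule_format, of t] that \<omega>0 by (simp add: dist_real_def)
  with \<open>d > 0\<close> show ?thesis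
    using that by blast
qed

lemma moduli_tendsto_zero:
  assumes "\<omega> \<in> moduli"
    and g: "(g \<longlongrightarrow> 0) F" and nonneg: "\<And>x. g x \<ge> 0"
  shows "((\<lambda>x. \<omega> (g x)) \<longlongrightarrow> 0) F"
  unfolding tendsto_iff
proof (intro allI impI)
  fix e :: real assume "e > 0"
  then obtain d where d: "d > 0" "\<And>t. 0 \<le> t \<Longrightarrow> t < d \<Longrightarrow> \<omega> t < e"
    using moduli_small[OF assms(1)] by blast
  have "eventually (\<lambda>x. g x < d) F"
    using g \<open>d > 0\<close> by (rule order_tendstoD)
  then show "eventually (\<lambda>x. dist (\<omega> (g x)) 0 < e) F"
    by eventually_elim (use d(2) nonneg moduli_nonneg[OF assms(1)] in auto)
qed

text \<open>
  The graph of a concave function vanishing at \<open>0\<close> lies above its chords from the origin.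
\<close>
lemma concave_modulus_mult_le:
  assumes \<omega>: "concave_modulus \<omega>" and c: "c \<ge> 1" and t: "t \<ge> 0"
  shows "\<omega> (c * t) \<le> c * \<omega> t"
proof -
  have "(1 - 1 / c) * \<omega> 0 + (1 / c) * \<omega> (c * t) \<le> \<omega> ((1 - 1 / c) *\<^sub>R 0 + (1 / c) *\<^sub>R (c * t))"
    using \<omega> c t by (intro concave_onD[of "{0..}"]) (auto simp: concave_modulus_def)
  also have "(1 - 1 / c) *\<^sub>R 0 + (1 / c) *\<^sub>R (c * t) = t"
    using c by simp
  finally show ?thesis
    using c moduli_zero[of \<omega>] \<omega> by (simp add: concave_modulus_def field_simps)
qed

lemma concave_modulus_ratio_mono:
  assumes \<omega>: "concave_modulus \<omega>" and "0 < s" "s \<le> t"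
  shows "s * \<omega> t \<le> t * \<omega> s"
  using concave_modulus_mult_le[OF \<omega>, of "t / s" s] assms(2,3) by (simp add: field_simps)

text \<open>
  The bound \<open>m * r \<le> \<omega> r\<close> says that the tangent line at \<open>r\<close> meets the vertical axis at
  a nonnegative height, so that \<open>t\<close> times the tangent is a quadratic in \<open>t\<close> with nonnegative
  coefficients; it majorizes \<open>t * \<omega> t\<close>, with equality at \<open>r\<close>.
\<close>
lemma concave_modulus_supergradient:
  assumes \<omega>: "concave_modulus \<omega>" and r: "r > 0"
  obtains m where "m \<ge> 0" "m * r \<le> \<omega> r" "\<And>t. t \<ge> 0 \<Longrightarrow> \<omega> t \<le> \<omega> r + m * (t - r)"
proof -
  have mod: "\<omega> \<in> moduli" using \<omega> by (simp add: concave_modulus_def)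
  define m where "m = - Inf ((\<lambda>t. (- \<omega> r - - \<omega> t) / (r - t)) ` ({r<..} \<inter> {0..}))"
  have le: "\<omega> t \<le> \<omega> r + m * (t - r)" if "t \<ge> 0" for t
  proof -
    have "- \<omega> t \<ge> - \<omega> r + - m * (t - r)"
      unfolding m_def minus_minus using \<omega> r that
      by (intro convex_le_Inf_differential) (auto simp: concave_modulus_def concave_on_def)
    then show ?thesis by simp
  qed
  have "m \<ge> 0"
    using le[of "r + 1"] r moduli_mono[OF mod, of r "r + 1"] by simp
  moreover have "m * r \<le> \<omega> r"
    using le[of 0] moduli_zero[OF mod] by simp
  ultimately show ?thesis
    using le that by blast
qed

lemma modulus_times_id_mono:
  assumes \<omega>: "\<omega> \<in> moduli" and "0 \<le> s" "s \<le> t"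
  shows "s * \<omega> s \<le> t * \<omega> t"
  using assms moduli_mono[OF \<omega>, of s t] moduli_nonneg[OF \<omega>, of s] by (intro mult_mono) auto

lemma modulus_times_id_mult_le:
  assumes \<omega>: "concave_modulus \<omega>" and c: "c \<ge> 1" and t: "t \<ge> 0"
  shows "(c * t) * \<omega> (c * t) \<le> c^2 * (t * \<omega> t)"
proof -
  have "(c * t) * \<omega> (c * t) \<le> (c * t) * (c * \<omega> t)"
    using c t by (intro mult_left_mono concave_modulus_mult_le[OF \<omega>]) auto
  then show ?thesis by (simp add: power2_eq_square algebra_simps)
qed

section \<open>Functions that are convex up to a modulus\<close>

text \<open>
  The factor \<open>u * (1 - u)\<close> is essential.  The midpoint inequality alone, together with its analogue
  for \<open>- h\<close>, only puts \<open>h\<close> in a Zygmund class, which for general \<open>\<omega>\<close> contains functions without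
  derivatives; with the factor, the error of the chord inequality near an endpoint is proportional
  to the distance from that endpoint.
\<close>
definition paraconvex :: "(real \<Rightarrow> real) \<Rightarrow> real \<Rightarrow> ('a::real_normed_vector \<Rightarrow> real) \<Rightarrow> bool" where
  "paraconvex \<omega> C h \<longleftrightarrow> (\<forall>x y u. 0 \<le> u \<and> u \<le> 1 \<longrightarrow>
     h ((1 - u) *\<^sub>R x + u *\<^sub>R y)
       \<le> (1 - u) * h x + u * h y + C * (u * (1 - u)) * (norm (x - y) * \<omega> (norm (x - y))))"

lemma paraconvexD:
  assumes "paraconvex \<omega> C h" "0 \<le> u" "u \<le> 1"
  shows "h ((1 - u) *\<^sub>R x + u *\<^sub>R y)
       \<le> (1 - u) * h x + u * h y + C * (u * (1 - u)) * (norm (x - y) * \<omega> (norm (x - y)))"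
  using assms by (simp add: paraconvex_def)

lemma paraconvex_affine_translate:
  assumes h: "paraconvex \<omega> C h" and L: "linear L" and M: "M \<ge> 0"
  shows "paraconvex \<omega> (M * C) (\<lambda>x. c + L (x - p) + M * h (x - p))"
  unfolding paraconvex_def
proof (intro allI impI, elim conjE)
  fix x y :: 'a and u :: real
  assume u: "0 \<le> u" "u \<le> 1"
  let ?z = "(1 - u) *\<^sub>R x + u *\<^sub>R y"
  have z: "?z - p = (1 - u) *\<^sub>R (x - p) + u *\<^sub>R (y - p)"
    by (simp add: algebra_simps)
  have "L (?z - p) = (1 - u) * L (x - p) + u * L (y - p)"
    unfolding z using L by (simp add: linear_add linear_cmul)
  moreover have "M * h (?z - p) \<le> M * ((1 - u) * h (x - p) + u * h (y - p)
      + C * (u * (1 - u)) * (norm (x - y) * \<omega> (norm (x - y))))"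
    unfolding z using paraconvexD[OF h u, of "x - p" "y - p"] M by (intro mult_left_mono) auto
  ultimately show "c + L (?z - p) + M * h (?z - p)
      \<le> (1 - u) * (c + L (x - p) + M * h (x - p)) + u * (c + L (y - p) + M * h (y - p))
        + M * C * (u * (1 - u)) * (norm (x - y) * \<omega> (norm (x - y)))"
    by (simp add: algebra_simps)
qed

lemma paraconvex_SUP:
  fixes h :: "'i \<Rightarrow> 'a::real_normed_vector \<Rightarrow> real"
  assumes "I \<noteq> {}" and bdd: "\<And>x. bdd_above ((\<lambda>i. h i x) ` I)"
    and h: "\<And>i. i \<in> I \<Longrightarrow> paraconvex \<omega> C (h i)"
  shows "paraconvex \<omega> C (\<lambda>x. SUP i\<in>I. h i x)"
  unfolding paraconvex_def
proof (intro allI impI, elim conjE)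
  fix x y :: 'a and u :: real
  assume u: "0 \<le> u" "u \<le> 1"
  let ?z = "(1 - u) *\<^sub>R x + u *\<^sub>R y"
  let ?e = "C * (u * (1 - u)) * (norm (x - y) * \<omega> (norm (x - y)))"
  show "(SUP i\<in>I. h i ?z) \<le> (1 - u) * (SUP i\<in>I. h i x) + u * (SUP i\<in>I. h i y) + ?e"
  proof (rule cSUP_least[OF \<open>I \<noteq> {}\<close>])
    fix i assume i: "i \<in> I"
    have "h i ?z \<le> (1 - u) * h i x + u * h i y + ?e"
      by (rule paraconvexD[OF h[OF i] u])
    also have "\<dots> \<le> (1 - u) * (SUP i\<in>I. h i x) + u * (SUP i\<in>I. h i y) + ?e"
      using u i bdd by (intro add_right_mono add_mono[OF mult_left_mono mult_left_mono] cSUP_upper) auto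
    finally show "h i ?z \<le> (1 - u) * (SUP i\<in>I. h i x) + u * (SUP i\<in>I. h i y) + ?e" .
  qed
qed

text \<open>
  This closure property supplies the competitor in the proof of the insertion lemma.
\<close>
lemma paraconvex_combination_of_translates:
  assumes h: "paraconvex \<omega> C h" and v: "0 \<le> v" "v \<le> 1"
  shows "paraconvex \<omega> C (\<lambda>w. (1 - v) * h (w + a) + v * h (w + b) - K)"
  unfolding paraconvex_def
proof (intro allI impI, elim conjE)
  fix x y :: 'a and u :: real
  assume u: "0 \<le> u" "u \<le> 1"
  let ?z = "(1 - u) *\<^sub>R x + u *\<^sub>R y"
  let ?e = "C * (u * (1 - u)) * (norm (x - y) * \<omega> (norm (x - y)))"
  have tr: "h (?z + c) \<le> (1 - u) * h (x + c) + u * h (y + c) + ?e" for c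
  proof -
    have "?z + c = (1 - u) *\<^sub>R (x + c) + u *\<^sub>R (y + c)"
      by (simp add: algebra_simps)
    then show ?thesis
      using paraconvexD[OF h u, of "x + c" "y + c"] by simp
  qed
  have "(1 - v) * h (?z + a) + v * h (?z + b) \<le>
      (1 - v) * ((1 - u) * h (x + a) + u * h (y + a) + ?e)
      + v * ((1 - u) * h (x + b) + u * h (y + b) + ?e)"
    using v by (intro add_mono mult_left_mono tr) auto
  also have "\<dots> = (1 - u) * ((1 - v) * h (x + a) + v * h (x + b))
       + u * ((1 - v) * h (y + a) + v * h (y + b)) + ?e"
    by (simp add: algebra_simps)
  finally have "(1 - v) * h (?z + a) + v * h (?z + b) \<le> (1 - u) * ((1 - v) * h (x + a) + v * h (x + b))
       + u * ((1 - v) * h (y + a) + v * h (y + b)) + ?e" .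
  moreover have "(1 - u) * ((1 - v) * h (x + a) + v * h (x + b) - K)
       + u * ((1 - v) * h (y + a) + v * h (y + b) - K)
     = (1 - u) * ((1 - v) * h (x + a) + v * h (x + b))
       + u * ((1 - v) * h (y + a) + v * h (y + b)) - K"
    by (simp add: algebra_simps)
  ultimately show "(1 - v) * h (?z + a) + v * h (?z + b) - K
      \<le> (1 - u) * ((1 - v) * h (x + a) + v * h (x + b) - K)
       + u * ((1 - v) * h (y + a) + v * h (y + b) - K) + ?e"
    by linarith
qed

text \<open>
  A form of Ilmanen's lemma.  Let \<open>F\<close> be the supremum of all paraconvex functions below \<open>g\<close>.
  To bound \<open>F\<close> from below at \<open>(1 - u) x + u y\<close> by the chord through \<open>x\<close> and \<open>y\<close>, average the
  translates of \<open>F\<close> that carry this point to \<open>x\<close> and to \<open>y\<close>, and subtract the admissible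
  error.  The result is again paraconvex, and it lies below \<open>g\<close> because the same
  average of translates of \<open>g\<close>, less the error, does.  So it is one of the functions whose supremum is \<open>F\<close>.
\<close>
lemma paraconvex_insertion:
  fixes l g :: "'a::real_normed_vector \<Rightarrow> real"
  assumes l: "paraconvex \<omega> C l" and g: "paraconvex \<omega> C (\<lambda>x. - g x)" and lg: "\<And>x. l x \<le> g x"
  obtains F where "\<And>x. l x \<le> F x" "\<And>x. F x \<le> g x"
    "paraconvex \<omega> C F" "paraconvex \<omega> C (\<lambda>x. - F x)"
proof -
  define H where "H = {h. paraconvex \<omega> C h \<and> (\<forall>x. h x \<le> g x)}"
  define F where "F x = (SUP h\<in>H. h x)" for x
  have lH: "l \<in> H" using l lg by (simp add: H_def)
  have bdd: "bdd_above ((\<lambda>h. h x) ` H)" for x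
    by (rule bdd_aboveI[of _ "g x"]) (auto simp: H_def)
  have upper: "h x \<le> F x" if "h \<in> H" for h x
    unfolding F_def by (rule cSUP_upper[OF that bdd])
  have Fg: "F x \<le> g x" for x
    unfolding F_def using lH by (intro cSUP_least) (auto simp: H_def)
  have F: "paraconvex \<omega> C F"
    unfolding F_def using lH bdd by (intro paraconvex_SUP) (auto simp: H_def)
  have "paraconvex \<omega> C (\<lambda>x. - F x)"
    unfolding paraconvex_def
  proof (intro allI impI, elim conjE)
    fix x y :: 'a and u :: real
    assume u: "0 \<le> u" "u \<le> 1"
    let ?z = "(1 - u) *\<^sub>R x + u *\<^sub>R y"
    define K where "K = C * (u * (1 - u)) * (norm (x - y) * \<omega> (norm (x - y)))"
    \<comment> \<open>the chord through translates of \<open>F\<close>; its value at \<open>?z\<close> is the desired lower bound for \<open>F ?z\<close>\<close>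
    define h where "h w = (1 - u) * F (w + (x - ?z)) + u * F (w + (y - ?z)) - K" for w
    have "h w \<le> g w" for w
    proof -
      have w: "w = (1 - u) *\<^sub>R (w + (x - ?z)) + u *\<^sub>R (w + (y - ?z))"
        by (simp add: algebra_simps)
      have diff: "w + (x - ?z) - (w + (y - ?z)) = x - y"
        by simp
      have "- g w \<le> (1 - u) * - g (w + (x - ?z)) + u * - g (w + (y - ?z)) + K"
        unfolding K_def
        using paraconvexD[OF g u, of "w + (x - ?z)" "w + (y - ?z)", folded w, unfolded diff] .
      moreover have "(1 - u) * F (w + (x - ?z)) + u * F (w + (y - ?z))
          \<le> (1 - u) * g (w + (x - ?z)) + u * g (w + (y - ?z))"
        using u by (intro add_mono mult_left_mono Fg) auto
      ultimately show ?thesis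
        unfolding h_def by linarith
    qed
    moreover have "paraconvex \<omega> C h"
      unfolding h_def using F u by (rule paraconvex_combination_of_translates)
    ultimately have "h \<in> H" by (simp add: H_def)
    from upper[OF this, of ?z]
    show "- F ?z \<le> (1 - u) * - F x + u * - F y
        + C * (u * (1 - u)) * (norm (x - y) * \<omega> (norm (x - y)))"
      by (simp add: h_def K_def)
  qed
  with that[of F] upper[OF lH] Fg F show ?thesis by blast
qed

section \<open>Two-sided paraconvexity and differentiability\<close>

text \<open>
  The derivative is known only through estimates with relative error \<open>K * \<omega> (k * t)\<close> at scale \<open>t\<close>;
  this turns such estimates into exact identities.
\<close>
lemma nonpos_if_le_modulus:
  assumes \<omega>: "\<omega> \<in> moduli" and k: "k \<ge> 0" and le: "\<And>t. t > 0 \<Longrightarrow> A \<le> K * \<omega> (k * t)"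
  shows "A \<le> 0"
proof (rule tendsto_lowerbound)
  show "((\<lambda>t. K * \<omega> (k * \<bar>t\<bar>)) \<longlongrightarrow> 0) (at_right (0::real))"
  proof (rule tendsto_mult_right_zero, rule moduli_tendsto_zero[OF \<omega>])
    show "((\<lambda>t. k * \<bar>t\<bar>) \<longlongrightarrow> 0) (at_right (0::real))"
      by (auto intro!: tendsto_eq_intros)
  qed (use k in auto)
  show "\<forall>\<^sub>F t in at_right 0. A \<le> K * \<omega> (k * \<bar>t\<bar>)"
    using eventually_at_right_less by eventually_elim (use le in auto)
qed auto

lemma paraconvex_two_sided:
  assumes "paraconvex \<omega> C F" "paraconvex \<omega> C (\<lambda>x. - F x)" "0 \<le> u" "u \<le> 1"
  shows "\<bar>F ((1 - u) *\<^sub>R x + u *\<^sub>R y) - (1 - u) * F x - u * F y\<bar>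
    \<le> C * (u * (1 - u)) * (norm (x - y) * \<omega> (norm (x - y)))"
  using paraconvexD[OF assms(1,3,4), of x y] paraconvexD[OF assms(2,3,4), of x y]
  by (simp add: abs_le_iff)

text \<open>
  The two-sided chord inequality between \<open>x\<close> and \<open>x + t h\<close> compares the difference quotients at
  scales \<open>s \<le> t\<close>: they differ by at most \<open>C * norm h * \<omega> (t * norm h)\<close>.  So the quotients are Cauchy
  as the scale shrinks, and the same bound survives in the limit as the remainder estimate.
\<close>
lemma paraconvex_both_directional_derivative:
  fixes F :: "'a::real_normed_vector \<Rightarrow> real"
  assumes \<omega>: "\<omega> \<in> moduli" and C: "C \<ge> 0"
    and F: "paraconvex \<omega> C F" "paraconvex \<omega> C (\<lambda>x. - F x)"
  obtains D where "\<And>x h t. t > 0 \<Longrightarrow>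
    \<bar>F (x + t *\<^sub>R h) - F x - t * D x h\<bar> \<le> C * (t * norm h) * \<omega> (t * norm h)"
proof -
  define q where "q x h t = (F (x + t *\<^sub>R h) - F x) / t" for x h t
  have q: "\<bar>q x h s - q x h t\<bar> \<le> C * norm h * \<omega> (t * norm h)" if st: "0 < s" "s \<le> t" for x h s t
  proof -
    define u where "u = s / t"
    have u: "0 \<le> u" "u \<le> 1" and ut: "u * t = s" using st by (auto simp: u_def)
    have z: "(1 - u) *\<^sub>R x + u *\<^sub>R (x + t *\<^sub>R h) = x + s *\<^sub>R h"
      using ut by (simp add: algebra_simps)
    have "norm (x - (x + t *\<^sub>R h)) = t * norm h" using st by simp
    then have "\<bar>F (x + s *\<^sub>R h) - (1 - u) * F x - u * F (x + t *\<^sub>R h)\<bar>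
        \<le> C * (u * (1 - u)) * ((t * norm h) * \<omega> (t * norm h))"
      using paraconvex_two_sided[OF F u, of x "x + t *\<^sub>R h"] by (simp only: z)
    also have "\<dots> = (1 - u) * (C * norm h * \<omega> (t * norm h) * (u * t))"
      by (simp add: algebra_simps)
    also have "\<dots> \<le> 1 * (C * norm h * \<omega> (t * norm h) * (u * t))"
      using u st C moduli_nonneg[OF \<omega>] by (intro mult_right_mono) auto
    finally have le: "\<bar>F (x + s *\<^sub>R h) - (1 - u) * F x - u * F (x + t *\<^sub>R h)\<bar>
        \<le> C * norm h * \<omega> (t * norm h) * s"
      by (simp add: ut)
    have "q x h s - q x h t = (F (x + s *\<^sub>R h) - (1 - u) * F x - u * F (x + t *\<^sub>R h)) / s"
      using st by (simp add: q_def u_def field_simps)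
    then show ?thesis
      using le st by (simp add: pos_divide_le_eq)
  qed
  define D where "D x h = lim (\<lambda>n. q x h (1 / real (Suc n)))" for x h
  have lim: "(\<lambda>n. q x h (1 / real (Suc n))) \<longlonglongrightarrow> D x h" for x h
  proof -
    have "(\<lambda>n. C * norm h * \<omega> (1 / real (Suc n) * norm h)) \<longlonglongrightarrow> 0"
      using LIMSEQ_inverse_real_of_nat
      by (intro tendsto_mult_right_zero moduli_tendsto_zero[OF \<omega>] tendsto_mult_left_zero)
        (auto simp: inverse_eq_divide)
    from order_tendstoD(2)[OF this]
    have small: "\<exists>N. C * norm h * \<omega> (1 / real (Suc N) * norm h) < e" if "e > 0" for e
      using that unfolding eventually_sequentially by blast
    have "Cauchy (\<lambda>n. q x h (1 / real (Suc n)))"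
      unfolding Cauchy_altdef2
    proof (intro allI impI)
      fix e :: real assume "e > 0"
      then obtain N where N: "C * norm h * \<omega> (1 / real (Suc N) * norm h) < e"
        using small by blast
      have "dist (q x h (1 / real (Suc n))) (q x h (1 / real (Suc N))) < e" if "n \<ge> N" for n
        using q[of "1 / real (Suc n)" "1 / real (Suc N)" x h] N that
        by (simp add: dist_real_def field_simps)
      then show "\<exists>N. \<forall>n\<ge>N. dist (q x h (1 / real (Suc n))) (q x h (1 / real (Suc N))) < e"
        by blast
    qed
    then show ?thesis
      unfolding D_def using Cauchy_convergent convergent_LIMSEQ_iff by blast
  qed
  show ?thesis
  proof (rule that[of D])
    fix x h and t :: real assume t: "t > 0"
    have "\<bar>D x h - q x h t\<bar> \<le> C * norm h * \<omega> (t * norm h)"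
    proof (rule tendsto_upperbound)
      show "(\<lambda>n. \<bar>q x h (1 / real (Suc n)) - q x h t\<bar>) \<longlonglongrightarrow> \<bar>D x h - q x h t\<bar>"
        by (intro tendsto_intros lim)
      have "(\<lambda>n. 1 / real (Suc n)) \<longlonglongrightarrow> 0"
        using LIMSEQ_inverse_real_of_nat by (simp add: inverse_eq_divide)
      then have "\<forall>\<^sub>F n in sequentially. 1 / real (Suc n) < t"
        using t by (rule order_tendstoD)
      then show "\<forall>\<^sub>F n in sequentially. \<bar>q x h (1 / real (Suc n)) - q x h t\<bar>
          \<le> C * norm h * \<omega> (t * norm h)"
        by eventually_elim (intro q, auto)
    qed auto
    then have "t * \<bar>q x h t - D x h\<bar> \<le> t * (C * norm h * \<omega> (t * norm h))"
      using t by (intro mult_left_mono) (auto simp: abs_minus_commute)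
    moreover have "F (x + t *\<^sub>R h) - F x - t * D x h = t * (q x h t - D x h)"
      using t by (simp add: q_def field_simps)
    then have "\<bar>F (x + t *\<^sub>R h) - F x - t * D x h\<bar> = t * \<bar>q x h t - D x h\<bar>"
      using t by (simp add: abs_mult)
    ultimately show "\<bar>F (x + t *\<^sub>R h) - F x - t * D x h\<bar> \<le> C * (t * norm h) * \<omega> (t * norm h)"
      by (simp add: algebra_simps)
  qed
qed

text \<open>
  The directional derivatives are additive because the chord inequality at midpoints has an error
  \<open>o(t)\<close>, and local boundedness of \<open>F\<close> makes them bounded.  The derivatives at \<open>x\<close> and
  \<open>y\<close> are compared by expanding \<open>F\<close> at a third point from both, at distance comparable to
  \<open>norm (x - y)\<close>; all remainders are then of order \<open>norm (x - y) * \<omega> (norm (x - y))\<close>.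
\<close>
lemma paraconvex_both_imp_C1:
  fixes F :: "'a::real_normed_vector \<Rightarrow> real"
  assumes \<omega>c: "concave_modulus \<omega>" and C: "C \<ge> 0"
    and F: "paraconvex \<omega> C F" "paraconvex \<omega> C (\<lambda>x. - F x)"
    and bdd: "\<And>x. \<exists>B. \<forall>h. norm h \<le> 1 \<longrightarrow> \<bar>F (x + h)\<bar> \<le> B"
  shows "F \<in> C1_omega \<omega> UNIV"
proof -
  have \<omega>: "\<omega> \<in> moduli" using \<omega>c by (simp add: concave_modulus_def)
  obtain D where D: "\<And>x h t. t > 0 \<Longrightarrow>
      \<bar>F (x + t *\<^sub>R h) - F x - t * D x h\<bar> \<le> C * (t * norm h) * \<omega> (t * norm h)"
    using paraconvex_both_directional_derivative[OF \<omega> C F] by blast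
  have D1: "\<bar>F (x + h) - F x - D x h\<bar> \<le> C * norm h * \<omega> (norm h)" for x h
    using D[of 1 x h] by simp
  have Dk: "\<bar>F (x + t *\<^sub>R h) - F x - t * D x h\<bar> \<le> C * (t * k) * \<omega> (t * k)"
    if "t > 0" "norm h \<le> k" for x h t k
  proof -
    have "0 \<le> t * norm h" "t * norm h \<le> t * k" using that by auto
    from mult_left_mono[OF modulus_times_id_mono[OF \<omega> this] C]
    have "C * ((t * norm h) * \<omega> (t * norm h)) \<le> C * ((t * k) * \<omega> (t * k))" .
    then show ?thesis
      using D[OF that(1), of x h] by (simp add: mult.assoc)
  qed
  have zeroI: "A = 0" if "k \<ge> 0" "\<And>t. t > 0 \<Longrightarrow> \<bar>t * A\<bar> \<le> K * t * \<omega> (k * t)" for A K k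
  proof -
    have "\<bar>A\<bar> \<le> 0"
    proof (rule nonpos_if_le_modulus[OF \<omega> \<open>k \<ge> 0\<close>])
      fix t :: real assume "t > 0"
      with that(2)[OF this] show "\<bar>A\<bar> \<le> K * \<omega> (k * t)"
        by (simp add: abs_mult field_simps)
    qed
    then show ?thesis by simp
  qed
  have D_pos: "D x (r *\<^sub>R h) = r * D x h" if r: "r > 0" for x r h
  proof -
    define k where "k = r * norm h"
    have "D x (r *\<^sub>R h) - r * D x h = 0"
    proof (rule zeroI[of k _ "2 * C * k"])
      show "k \<ge> 0" using r by (simp add: k_def)
      fix t :: real assume t: "t > 0"
      have "\<bar>F (x + t *\<^sub>R (r *\<^sub>R h)) - F x - t * D x (r *\<^sub>R h)\<bar> \<le> C * (t * k) * \<omega> (t * k)"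
        using r t by (intro Dk) (auto simp: k_def)
      moreover have "\<bar>F (x + (t * r) *\<^sub>R h) - F x - (t * r) * D x h\<bar> \<le> C * (t * k) * \<omega> (t * k)"
        using D[of "t * r" x h] r t by (simp add: k_def mult.assoc)
      ultimately have "\<bar>t * D x (r *\<^sub>R h) - (t * r) * D x h\<bar> \<le> 2 * (C * (t * k) * \<omega> (t * k))"
        by simp
      then show "\<bar>t * (D x (r *\<^sub>R h) - r * D x h)\<bar> \<le> 2 * C * k * t * \<omega> (k * t)"
        by (simp add: algebra_simps)
    qed
    then show ?thesis by simp
  qed
  have D_add: "D x (h + k) = D x h + D x k" for x h k
  proof -
    define m where "m = norm h + norm k"
    have m: "m \<ge> 0" by (simp add: m_def)
    have "D x (h + k) - (D x h + D x k) = 0"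
    proof (rule zeroI[of "2 * m" _ "5 * C * m"])
      show "2 * m \<ge> 0" using m by simp
      fix t :: real assume t: "t > 0"
      let ?e = "C * (t * m) * \<omega> (t * (2 * m))"
      have "(1 - 1/2) *\<^sub>R (x + (2 * t) *\<^sub>R h) + (1/2) *\<^sub>R (x + (2 * t) *\<^sub>R k) = x + t *\<^sub>R (h + k)"
        by (simp add: algebra_simps flip: scaleR_add_left)
      then have "\<bar>F (x + t *\<^sub>R (h + k)) - (1 - 1/2) * F (x + (2 * t) *\<^sub>R h) - 1/2 * F (x + (2 * t) *\<^sub>R k)\<bar>
          \<le> C * (1/2 * (1 - 1/2)) * (norm (x + (2 * t) *\<^sub>R h - (x + (2 * t) *\<^sub>R k))
            * \<omega> (norm (x + (2 * t) *\<^sub>R h - (x + (2 * t) *\<^sub>R k))))"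
        using paraconvex_two_sided[OF F, of "1/2" "x + (2 * t) *\<^sub>R h" "x + (2 * t) *\<^sub>R k"] by simp
      also have "\<dots> \<le> C * (1/2 * (1 - 1/2)) * ((t * (2 * m)) * \<omega> (t * (2 * m)))"
      proof (intro mult_left_mono modulus_times_id_mono[OF \<omega>])
        have "norm (x + (2 * t) *\<^sub>R h - (x + (2 * t) *\<^sub>R k)) = 2 * t * norm (h - k)"
          using t by (simp flip: scaleR_right_diff_distrib)
        also have "\<dots> \<le> 2 * t * m"
          using t norm_triangle_ineq4[of h k] by (intro mult_left_mono) (auto simp: m_def)
        finally show "norm (x + (2 * t) *\<^sub>R h - (x + (2 * t) *\<^sub>R k)) \<le> t * (2 * m)"
          by simp
      qed (use C in auto)
      also have "\<dots> = ?e / 2" by simp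
      finally have 1: "\<bar>F (x + t *\<^sub>R (h + k)) - 1/2 * F (x + (2 * t) *\<^sub>R h) - 1/2 * F (x + (2 * t) *\<^sub>R k)\<bar>
          \<le> ?e / 2" by simp
      have 2: "\<bar>F (x + (2 * t) *\<^sub>R h) - F x - (2 * t) * D x h\<bar> \<le> 2 * ?e"
        using Dk[of "2 * t" h m x] t by (simp add: m_def algebra_simps)
      have 3: "\<bar>F (x + (2 * t) *\<^sub>R k) - F x - (2 * t) * D x k\<bar> \<le> 2 * ?e"
        using Dk[of "2 * t" k m x] t by (simp add: m_def algebra_simps)
      have 4: "\<bar>F (x + t *\<^sub>R (h + k)) - F x - t * D x (h + k)\<bar> \<le> 2 * ?e"
      proof -
        have "norm (h + k) \<le> 2 * m"
          using norm_triangle_ineq[of h k, folded m_def] m by linarith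
        from Dk[OF t this, of x] show ?thesis by simp
      qed
      have "\<bar>t * D x (h + k) - (t * D x h + t * D x k)\<bar> \<le> 5 * ?e"
        using 1 2 3 4 unfolding abs_le_iff by linarith
      then show "\<bar>t * (D x (h + k) - (D x h + D x k))\<bar> \<le> 5 * C * m * t * \<omega> (2 * m * t)"
        by (simp add: algebra_simps)
    qed
    then show ?thesis by simp
  qed
  have D_zero: "D x 0 = 0" for x using D_add[of x 0 0] by simp
  have D_minus: "D x (- h) = - D x h" for x h using D_add[of x h "- h"] D_zero by simp
  have D_scale: "D x (r *\<^sub>R h) = r * D x h" for x r h
  proof (cases r "0::real" rule: linorder_cases)
    case less
    then show ?thesis using D_pos[of "- r" x h] D_minus[of x "r *\<^sub>R h"] by simp
  next
    case greater
    then show ?thesis by (rule D_pos)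
  qed (simp add: D_zero)
  have bl: "bounded_linear (D x)" for x
  proof -
    obtain B where B: "\<And>h. norm h \<le> 1 \<Longrightarrow> \<bar>F (x + h)\<bar> \<le> B"
      using bdd[of x] by blast
    have unit: "\<bar>D x h\<bar> \<le> 2 * B + C * \<omega> 1" if "norm h = 1" for h
      using D1[of x h] B[of h] B[of 0] that by (simp add: abs_le_iff)
    show ?thesis
    proof (rule bounded_linear_intro[of _ "2 * B + C * \<omega> 1"])
      fix h
      show "norm (D x h) \<le> norm h * (2 * B + C * \<omega> 1)"
      proof (cases "h = 0")
        case False
        then show ?thesis
          using unit[of "(1 / norm h) *\<^sub>R h"] unfolding D_scale
          by (simp add: abs_mult field_simps)
      qed (simp add: D_zero)
    qed (simp_all add: D_add D_scale)
  qed
  have der: "(F has_derivative D x) (at x)" for x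
  proof (rule has_derivativeI_sandwich[of 1])
    show "((\<lambda>y. C * \<omega> (norm (y - x))) \<longlongrightarrow> 0) (at x)"
      by (intro tendsto_mult_right_zero moduli_tendsto_zero[OF \<omega>] tendsto_norm_zero LIM_zero
          tendsto_ident_at norm_ge_zero)
    fix y assume "y \<noteq> x"
    then show "norm (F y - F x - D x (y - x)) / norm (y - x) \<le> C * \<omega> (norm (y - x))"
      using D1[of x "y - x"] by (simp add: pos_divide_le_eq algebra_simps)
  qed (use bl in auto)
  have fd: "frechet_derivative F (at x) = D x" for x
    using frechet_derivative_at[OF der] by simp
  have onorm: "onorm (\<lambda>h. D x h - D y h) \<le> (6 * C) * \<omega> (norm (x - y))" for x y
  proof (rule onorm_bound)
    show "0 \<le> 6 * C * \<omega> (norm (x - y))" using C moduli_nonneg[OF \<omega>] by simp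
    fix h
    show "norm (D x h - D y h) \<le> 6 * C * \<omega> (norm (x - y)) * norm h"
    proof (cases "x = y \<or> h = 0")
      case True
      then show ?thesis using C moduli_nonneg[OF \<omega>] D_zero by auto
    next
      case False
      define r where "r = norm (x - y)"
      have r: "r > 0" using False by (simp add: r_def)
      \<comment> \<open>\<open>h\<close> rescaled to the length of \<open>x - y\<close>, the scale at which the remainders balance\<close>
      define k where "k = (r / norm h) *\<^sub>R h"
      have nk: "norm k = r" using False r by (simp add: k_def)
      let ?e = "C * (r * \<omega> r)"
      \<comment> \<open>three expansions that together reach \<open>x + k\<close> both directly from \<open>x\<close> and from \<open>y\<close>\<close>
      have 1: "\<bar>F (x + k) - F x - D x k\<bar> \<le> ?e" using D1[of x k] nk by (simp add: mult.assoc)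
      have 2: "\<bar>F (y + (x - y)) - F y - D y (x - y)\<bar> \<le> ?e"
        using D1[of y "x - y"] by (simp add: r_def mult.assoc)
      have "\<bar>F (y + 1 *\<^sub>R (x - y + k)) - F y - 1 * D y (x - y + k)\<bar> \<le> C * (1 * (2 * r)) * \<omega> (1 * (2 * r))"
        using norm_triangle_ineq[of "x - y" k] nk by (intro Dk) (auto simp: r_def)
      also have "\<dots> = C * ((2 * r) * \<omega> (2 * r))" by simp
      also have "\<dots> \<le> C * (2^2 * (r * \<omega> r))"
        using r C by (intro mult_left_mono modulus_times_id_mult_le[OF \<omega>c]) auto
      also have "y + 1 *\<^sub>R (x - y + k) = x + k" by simp
      finally have 3: "\<bar>F (x + k) - F y - D y (x - y) - D y k\<bar> \<le> 4 * ?e"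
        by (simp add: D_add diff_diff_eq add.assoc)
      have "\<bar>D x k - D y k\<bar> \<le> 6 * ?e"
        using 1 2 3 by (simp add: abs_le_iff)
      moreover have "D x k - D y k = (r / norm h) * (D x h - D y h)"
        by (simp add: k_def D_scale algebra_simps)
      ultimately have "(r / norm h) * \<bar>D x h - D y h\<bar> \<le> 6 * ?e"
        using r by (simp add: abs_mult)
      then have "r * \<bar>D x h - D y h\<bar> \<le> r * (6 * C * \<omega> r * norm h)"
        using False by (simp add: field_simps)
      then show ?thesis
        using r unfolding r_def[symmetric] by simp
    qed
  qed
  show ?thesis
    unfolding C1_omega_def
    using der onorm C by (auto simp: fd differentiable_def intro!: exI[of _ "6 * C"])
qed

section \<open>Norms with modulus of smoothness of power type 2\<close>

lemma is_norm_zero: "is_norm N \<Longrightarrow> N 0 = 0"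
  and is_norm_scale: "is_norm N \<Longrightarrow> N (c *\<^sub>R x) = \<bar>c\<bar> * N x"
  and is_norm_triangle: "is_norm N \<Longrightarrow> N (x + y) \<le> N x + N y"
  and is_norm_eq_zero: "is_norm N \<Longrightarrow> N x = 0 \<Longrightarrow> x = 0"
  by (auto simp: is_norm_def)

lemma is_norm_minus: "is_norm N \<Longrightarrow> N (- x) = N x"
  using is_norm_scale[of N "-1" x] by simp

lemma is_norm_nonneg: "is_norm N \<Longrightarrow> 0 \<le> N x"
  using is_norm_triangle[of N x "- x"] is_norm_minus[of N x] is_norm_zero[of N] by simp

lemma is_norm_diff_le: "is_norm N \<Longrightarrow> \<bar>N x - N y\<bar> \<le> N (x - y)"
  using is_norm_triangle[of N "x - y" y] is_norm_triangle[of N "y - x" x]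
    is_norm_minus[of N "x - y"] by (simp add: abs_le_iff)

lemma modulus_of_smoothness_upper:
  assumes N: "is_norm N" and xy: "N x = 1" "N y = 1"
  shows "(N (x + \<tau> *\<^sub>R y) + N (x - \<tau> *\<^sub>R y)) / 2 - 1 \<le> modulus_of_smoothness N \<tau>"
  unfolding modulus_of_smoothness_def
proof (rule cSup_upper)
  show "bdd_above (insert 0 {(N (x + \<tau> *\<^sub>R y) + N (x - \<tau> *\<^sub>R y)) / 2 - 1 |x y. N x = 1 \<and> N y = 1})"
  proof (rule bdd_aboveI[of _ "\<bar>\<tau>\<bar>"])
    fix r assume "r \<in> insert 0 {(N (x + \<tau> *\<^sub>R y) + N (x - \<tau> *\<^sub>R y)) / 2 - 1 |x y. N x = 1 \<and> N y = 1}"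
    then show "r \<le> \<bar>\<tau>\<bar>"
    proof
      assume "r \<in> {(N (x + \<tau> *\<^sub>R y) + N (x - \<tau> *\<^sub>R y)) / 2 - 1 |x y. N x = 1 \<and> N y = 1}"
      then obtain v w where r: "r = (N (v + \<tau> *\<^sub>R w) + N (v - \<tau> *\<^sub>R w)) / 2 - 1" "N v = 1" "N w = 1"
        by blast
      have "N (v + \<tau> *\<^sub>R w) \<le> 1 + \<bar>\<tau>\<bar>" "N (v - \<tau> *\<^sub>R w) \<le> 1 + \<bar>\<tau>\<bar>"
        using is_norm_triangle[OF N, of v "\<tau> *\<^sub>R w"] is_norm_triangle[OF N, of v "- (\<tau> *\<^sub>R w)"] r
        by (simp_all add: is_norm_minus[OF N] is_norm_scale[OF N])
      then show ?thesis unfolding r by argo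
    qed simp
  qed
qed (use xy in blast)

text \<open>
  With \<open>A = N (x + h)\<close>, \<open>B = N (x - h)\<close> and \<open>n = N x\<close>,
  \<open>A\<^sup>2 + B\<^sup>2 - 2 n\<^sup>2 = (A - n)\<^sup>2 + (B - n)\<^sup>2 + 2 n (A + B - 2 n)\<close>.  The two squares are at most
  \<open>(N h)\<^sup>2\<close> by the triangle inequality.  The modulus of smoothness, rescaled from the unit sphere with
  \<open>\<tau> = N h / N x\<close>, bounds \<open>A + B - 2 n\<close> by a multiple of \<open>(N h)\<^sup>2 / n\<close>; squaring the norm removes
  the singularity at \<open>n = 0\<close>.
\<close>
lemma square_second_difference:
  assumes N: "is_norm N" and smooth: "smoothness_power_type N 2"
  obtains K where "K \<ge> 0" "\<And>x h. (N (x + h))\<^sup>2 + (N (x - h))\<^sup>2 \<le> 2 * (N x)\<^sup>2 + K * (N h)\<^sup>2"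
proof -
  obtain K where K: "K > 0" "\<And>\<tau>. \<tau> \<ge> 0 \<Longrightarrow> modulus_of_smoothness N \<tau> \<le> K * \<tau> powr 2"
    using smooth by (auto simp: smoothness_power_type_def)
  have "(N (x + h))\<^sup>2 + (N (x - h))\<^sup>2 \<le> 2 * (N x)\<^sup>2 + (2 + 4 * K) * (N h)\<^sup>2" for x h
  proof (cases "x = 0 \<or> h = 0")
    case True
    then show ?thesis
      using \<open>K > 0\<close> by (auto simp: is_norm_zero[OF N] is_norm_minus[OF N] algebra_simps)
  next
    case False
    then have pos: "N x > 0" "N h > 0"
      using is_norm_nonneg[OF N] is_norm_eq_zero[OF N] by (metis order_le_less)+
    define \<tau> where "\<tau> = N h / N x"
    define v w where "v = (1 / N x) *\<^sub>R x" and "w = (1 / N h) *\<^sub>R h"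
    have \<tau>: "\<tau> > 0" using pos by (simp add: \<tau>_def)
    have unit: "N v = 1" "N w = 1"
      using pos by (simp_all add: v_def w_def is_norm_scale[OF N])
    have x: "x = N x *\<^sub>R v" and h: "h = N x *\<^sub>R (\<tau> *\<^sub>R w)"
      using pos by (simp_all add: v_def w_def \<tau>_def)
    have plus: "N (x + h) = N x * N (v + \<tau> *\<^sub>R w)"
      using pos is_norm_scale[OF N, of "N x" "v + \<tau> *\<^sub>R w"] x h by (simp add: scaleR_add_right)
    have minus: "N (x - h) = N x * N (v - \<tau> *\<^sub>R w)"
      using pos is_norm_scale[OF N, of "N x" "v - \<tau> *\<^sub>R w"] x h by (simp add: scaleR_diff_right)
    have "(N (v + \<tau> *\<^sub>R w) + N (v - \<tau> *\<^sub>R w)) / 2 - 1 \<le> K * \<tau>\<^sup>2"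
      using order_trans[OF modulus_of_smoothness_upper[OF N unit] K(2)[of \<tau>]] \<tau> by simp
    then have "N (v + \<tau> *\<^sub>R w) + N (v - \<tau> *\<^sub>R w) \<le> 2 + 2 * K * \<tau>\<^sup>2"
      by argo
    then have "N x * N x * (N (v + \<tau> *\<^sub>R w) + N (v - \<tau> *\<^sub>R w)) \<le> N x * N x * (2 + 2 * K * \<tau>\<^sup>2)"
      using pos by (intro mult_left_mono) auto
    also have "N x * N x * (2 + 2 * K * \<tau>\<^sup>2) = 2 * (N x)\<^sup>2 + 2 * K * (N x * \<tau>)\<^sup>2"
      by (simp add: power2_eq_square algebra_simps)
    also have "N x * \<tau> = N h"
      using pos by (simp add: \<tau>_def)
    finally have A: "N x * (N (x + h) + N (x - h)) \<le> 2 * (N x)\<^sup>2 + 2 * K * (N h)\<^sup>2"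
      unfolding plus minus by (simp add: algebra_simps)
    have B: "(N (x + h) - N x)\<^sup>2 \<le> (N h)\<^sup>2" "(N (x - h) - N x)\<^sup>2 \<le> (N h)\<^sup>2"
      using is_norm_diff_le[OF N, of "x + h" x] is_norm_diff_le[OF N, of "x - h" x]
        is_norm_nonneg[OF N, of h]
      by (simp_all add: is_norm_minus[OF N] flip: abs_le_square_iff)
    show ?thesis
      using A B by (simp add: power2_eq_square algebra_simps)
  qed
  with that[of "2 + 4 * K"] \<open>K > 0\<close> show ?thesis by simp
qed

text \<open>
  The midpoint inequality on the largest symmetric interval around a maximum point involves an endpoint of
  \<open>{0..1}\<close>, so a positive maximum would be at most half of itself.
\<close>
lemma midpoint_convex_nonpos:
  fixes w :: "real \<Rightarrow> real"
  assumes cont: "continuous_on {0..1} w" and "w 0 \<le> 0" "w 1 \<le> 0"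
    and mid: "\<And>t s. 0 \<le> s \<Longrightarrow> 0 \<le> t - s \<Longrightarrow> t + s \<le> 1 \<Longrightarrow> 2 * w t \<le> w (t - s) + w (t + s)"
    and u: "u \<in> {0..1}"
  shows "w u \<le> 0"
proof -
  obtain t where t: "t \<in> {0..1}" and max: "\<And>s. s \<in> {0..1} \<Longrightarrow> w s \<le> w t"
    using continuous_attains_sup[OF _ _ cont] by auto
  have "w t \<le> 0"
  proof (cases "t \<le> 1 / 2")
    case True
    then show ?thesis
      using mid[of t t] max[of "t + t"] t \<open>w 0 \<le> 0\<close> by simp
  next
    case False
    then show ?thesis
      using mid[of "1 - t" t] max[of "t - (1 - t)"] t \<open>w 1 \<le> 0\<close> by simp
  qed
  with max[OF u] show ?thesis by simp
qed

text \<open>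
  Along a segment the defect is continuous, and the quadratic correction makes it midpoint convex:
  the second difference of \<open>t * (1 - t)\<close> is exactly \<open>- 2 * s\<^sup>2\<close>.
\<close>
lemma square_semiconcave:
  assumes N: "is_norm N" and smooth: "smoothness_power_type N 2"
  obtains K where "K \<ge> 0" "\<And>x y u. 0 \<le> u \<Longrightarrow> u \<le> 1 \<Longrightarrow>
    (1 - u) * (N x)\<^sup>2 + u * (N y)\<^sup>2 \<le> (N ((1 - u) *\<^sub>R x + u *\<^sub>R y))\<^sup>2 + K * (u * (1 - u)) * (N (x - y))\<^sup>2"
proof -
  obtain K where K: "K \<ge> 0"
    and sd: "\<And>x h. (N (x + h))\<^sup>2 + (N (x - h))\<^sup>2 \<le> 2 * (N x)\<^sup>2 + K * (N h)\<^sup>2"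
    using square_second_difference[OF assms] by blast
  have "(1 - u) * (N x)\<^sup>2 + u * (N y)\<^sup>2
      \<le> (N ((1 - u) *\<^sub>R x + u *\<^sub>R y))\<^sup>2 + K / 2 * (u * (1 - u)) * (N (x - y))\<^sup>2"
    if u: "0 \<le> u" "u \<le> 1" for x y u
  proof -
    define z where "z t = (1 - t) *\<^sub>R x + t *\<^sub>R y" for t
    define w where "w t = (1 - t) * (N x)\<^sup>2 + t * (N y)\<^sup>2 - (N (z t))\<^sup>2
        - K / 2 * (t * (1 - t)) * (N (x - y))\<^sup>2" for t
    have zdiff: "z (t + s) = z t + s *\<^sub>R (y - x)" "z (t - s) = z t - s *\<^sub>R (y - x)" for t s
      by (simp_all add: z_def algebra_simps)
    have Nyx: "N (y - x) = N (x - y)" using is_norm_minus[OF N, of "x - y"] by simp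
    have "(N (x - y))-lipschitz_on {0..1} (\<lambda>t. N (z t))"
    proof (rule lipschitz_onI)
      fix s t :: real
      have "z s - z t = (s - t) *\<^sub>R (y - x)"
        by (simp add: z_def algebra_simps)
      then show "dist (N (z s)) (N (z t)) \<le> N (x - y) * dist s t"
        using is_norm_diff_le[OF N, of "z s" "z t"]
        by (simp add: dist_real_def is_norm_scale[OF N] Nyx mult.commute)
    qed (rule is_norm_nonneg[OF N])
    then have contN: "continuous_on {0..1} (\<lambda>t. N (z t))"
      by (rule lipschitz_on_continuous_on)
    have "w u \<le> 0"
    proof (rule midpoint_convex_nonpos[of w])
      show "continuous_on {0..1} w"
        unfolding w_def by (intro continuous_intros contN)
      show "w 0 \<le> 0" "w 1 \<le> 0" by (simp_all add: w_def z_def)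
      fix t s :: real
      have "(N (z (t + s)))\<^sup>2 + (N (z (t - s)))\<^sup>2 \<le> 2 * (N (z t))\<^sup>2 + K * (s\<^sup>2 * (N (x - y))\<^sup>2)"
        using sd[of "z t" "s *\<^sub>R (y - x)"]
        by (simp add: zdiff is_norm_scale[OF N] Nyx power_mult_distrib)
      moreover have "w (t - s) + w (t + s) - 2 * w t
        = 2 * (N (z t))\<^sup>2 + K * (s\<^sup>2 * (N (x - y))\<^sup>2) - ((N (z (t + s)))\<^sup>2 + (N (z (t - s)))\<^sup>2)"
        by (simp add: w_def power2_eq_square field_simps)
      ultimately show "2 * w t \<le> w (t - s) + w (t + s)"
        by linarith
    qed (use u in auto)
    then show ?thesis by (simp add: w_def z_def)
  qed
  with that[of "K / 2"] K show ?thesis by simp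
qed

lemma modulus_times_id_lipschitz:
  assumes \<omega>: "concave_modulus \<omega>" and st: "0 \<le> s" "s \<le> R" "0 \<le> t" "t \<le> R"
  shows "t * \<omega> t - s * \<omega> s \<le> 2 * \<omega> R * \<bar>t - s\<bar>"
proof -
  have mod: "\<omega> \<in> moduli" using \<omega> by (simp add: concave_modulus_def)
  have R: "0 \<le> \<omega> R" "\<omega> s \<le> \<omega> R" "\<omega> t \<le> \<omega> R" 
    using st moduli_nonneg[OF mod, of R] moduli_mono[OF mod] by auto
  show ?thesis
  proof (cases "s < t")
    case False
    have "t * \<omega> t \<le> s * \<omega> s"
      using False st by (intro modulus_times_id_mono[OF mod]) auto
    moreover have "0 \<le> 2 * \<omega> R * \<bar>t - s\<bar>" using R by simp
    ultimately show ?thesis by linarith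
  next
    case True
    have "s * \<omega> t \<le> t * \<omega> s"
      using concave_modulus_ratio_mono[OF \<omega>, of s t] True st moduli_zero[OF mod] by (cases "s = 0") auto
    then have "t * \<omega> t - s * \<omega> s \<le> (t - s) * \<omega> t + (t - s) * \<omega> s"
      by (simp add: algebra_simps)
    also have "\<dots> \<le> (t - s) * \<omega> R + (t - s) * \<omega> R"
      using True R by (intro add_mono mult_left_mono) auto
    finally show ?thesis using True by (simp add: algebra_simps)
  qed
qed

text \<open>
  Let \<open>z\<close> be the intermediate point and \<open>d = N (x - y)\<close>.  If \<open>d \<le> N z\<close>, replace \<open>\<theta> (N w)\<close> by its
  quadratic majorant \<open>a * (N w)\<^sup>2 + const\<close> touching at \<open>z\<close>; then \<open>a \<le> \<omega> d / d\<close>, so that the error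
  \<open>a * d\<^sup>2\<close> of the square is at most \<open>\<theta> d\<close>.  If \<open>N z \<le> d\<close>, \<open>x\<close>, \<open>y\<close> and \<open>z\<close> have size at most \<open>2 * d\<close>,
  and the Lipschitz bound for \<open>\<theta>\<close> on \<open>{0..2 * d}\<close> gives an
  error \<open>u * \<theta> d\<close> from the endpoint nearer to \<open>z\<close>, which is comparable to \<open>u * (1 - u) * \<theta> d\<close>.
\<close>
lemma modulus_times_id_norm_semiconcave:
  assumes \<omega>: "concave_modulus \<omega>" and N: "is_norm N" and smooth: "smoothness_power_type N 2"
  obtains C where "C \<ge> 0" "\<And>x y u. 0 \<le> u \<Longrightarrow> u \<le> 1 \<Longrightarrow>
    (1 - u) * (N x * \<omega> (N x)) + u * (N y * \<omega> (N y))
      \<le> N ((1 - u) *\<^sub>R x + u *\<^sub>R y) * \<omega> (N ((1 - u) *\<^sub>R x + u *\<^sub>R y))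
        + C * (u * (1 - u)) * (N (x - y) * \<omega> (N (x - y)))"
proof -
  have mod: "\<omega> \<in> moduli" using \<omega> by (simp add: concave_modulus_def)
  obtain K where K: "K \<ge> 0" and sc: "\<And>x y u. 0 \<le> u \<Longrightarrow> u \<le> 1 \<Longrightarrow>
      (1 - u) * (N x)\<^sup>2 + u * (N y)\<^sup>2 \<le> (N ((1 - u) *\<^sub>R x + u *\<^sub>R y))\<^sup>2 + K * (u * (1 - u)) * (N (x - y))\<^sup>2"
    using square_semiconcave[OF N smooth] by blast
  define \<phi> where "\<phi> t = t * \<omega> t" for t
  have \<phi>0: "0 \<le> \<phi> t" if "0 \<le> t" for t
    using that moduli_nonneg[OF mod] by (simp add: \<phi>_def)
  have far_le: "(1 - u) * \<phi> (N x) + u * \<phi> (N y) \<le> \<phi> (N z) + K * (u * (1 - u)) * \<phi> (N (x - y))"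
    if u: "0 \<le> u" "u \<le> 1" and z: "z = (1 - u) *\<^sub>R x + u *\<^sub>R y" and d: "0 < N (x - y)" "N (x - y) \<le> N z"
    for x y z u
  proof -
    define r where "r = N z"
    define d where "d = N (x - y)"
    have r: "r > 0" "0 < d" "d \<le> r" using d by (auto simp: r_def d_def)
    obtain m where m: "m \<ge> 0" "m * r \<le> \<omega> r" "\<And>t. t \<ge> 0 \<Longrightarrow> \<omega> t \<le> \<omega> r + m * (t - r)"
      using concave_modulus_supergradient[OF \<omega> r(1)] by blast
    \<comment> \<open>\<open>t\<close> times the tangent line is \<open>m * t\<^sup>2 + b * t\<close>; the linear term is absorbed by \<open>2 * r * t \<le> t\<^sup>2 + r\<^sup>2\<close>, an equality at \<open>t = r\<close>\<close>
    define b where "b = \<omega> r - m * r"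
    define a where "a = m + b / (2 * r)"
    have b: "b \<ge> 0" using m by (simp add: b_def)
    have a: "a \<ge> 0" using m b r by (simp add: a_def)
    have quad: "\<phi> t \<le> a * t\<^sup>2 + b * r / 2" if "t \<ge> 0" for t
    proof -
      have "\<phi> t \<le> t * (\<omega> r + m * (t - r))"
        unfolding \<phi>_def using that m(3) by (intro mult_left_mono) auto
      also have "\<dots> = m * t\<^sup>2 + b * t"
        by (simp add: b_def power2_eq_square algebra_simps)
      also have "\<dots> \<le> m * t\<^sup>2 + b * ((t\<^sup>2 + r\<^sup>2) / (2 * r))"
      proof (intro add_left_mono mult_left_mono b)
        have "0 \<le> (t - r)\<^sup>2" by simp
        then show "t \<le> (t\<^sup>2 + r\<^sup>2) / (2 * r)"
          using r by (simp add: power2_eq_square field_simps)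
      qed
      also have "\<dots> = a * t\<^sup>2 + b * r / 2"
        using r by (simp add: a_def power2_eq_square field_simps)
      finally show ?thesis .
    qed
    have eq: "\<phi> r = a * r\<^sup>2 + b * r / 2"
      using r by (simp add: \<phi>_def a_def b_def power2_eq_square field_simps)
    have ad: "a * d\<^sup>2 \<le> \<phi> d"
    proof -
      have "b / (2 * r) \<le> b / r" using b r by (simp add: field_simps)
      then have "a * r \<le> \<omega> r"
        using r by (simp add: a_def b_def field_simps)
      then have "d * (a * r) \<le> d * \<omega> r" using r by (intro mult_left_mono) auto
      also have "\<dots> \<le> r * \<omega> d" using concave_modulus_ratio_mono[OF \<omega>, of d r] r by simp
      finally have "a * d \<le> \<omega> d" using r by (simp add: mult.commute)
      then show ?thesis
        using r by (simp add: \<phi>_def power2_eq_square)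
    qed
    have "(1 - u) * \<phi> (N x) + u * \<phi> (N y)
        \<le> (1 - u) * (a * (N x)\<^sup>2 + b * r / 2) + u * (a * (N y)\<^sup>2 + b * r / 2)"
      using u by (intro add_mono mult_left_mono quad is_norm_nonneg[OF N]) auto
    also have "\<dots> = a * ((1 - u) * (N x)\<^sup>2 + u * (N y)\<^sup>2) + b * r / 2"
    proof -
      have "(1 - u) * (a * X + k) + u * (a * Y + k) = a * ((1 - u) * X + u * Y) + k" for X Y k :: real
        by (simp add: algebra_simps)
      then show ?thesis .
    qed
    also have "\<dots> \<le> a * (r\<^sup>2 + K * (u * (1 - u)) * d\<^sup>2) + b * r / 2"
      unfolding r_def d_def z using u a by (intro add_right_mono mult_left_mono sc)
    also have "\<dots> = \<phi> r + K * (u * (1 - u)) * (a * d\<^sup>2)"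
      by (simp add: eq algebra_simps)
    also have "\<dots> \<le> \<phi> r + K * (u * (1 - u)) * \<phi> d"
      using u K ad by (intro add_left_mono mult_left_mono) auto
    finally show ?thesis by (simp add: r_def d_def)
  qed
  have near_le: "(1 - u) * \<phi> (N x) + u * \<phi> (N y) \<le> \<phi> (N z) + 16 * (u * (1 - u)) * \<phi> (N (x - y))"
    if u: "0 \<le> u" "u \<le> 1 / 2" and z: "z = (1 - u) *\<^sub>R x + u *\<^sub>R y" and small: "N z \<le> N (x - y)"
    for x y z u
  proof -
    define d where "d = N (x - y)"
    have d: "0 \<le> d" by (simp add: d_def is_norm_nonneg[OF N])
    have "x - z = u *\<^sub>R (x - y)" "y - z = (1 - u) *\<^sub>R (y - x)"
      by (simp_all add: z algebra_simps)
    then have diff: "N (x - z) = u * d" "N (y - z) = (1 - u) * d"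
      using u is_norm_minus[OF N, of "x - y"] by (simp_all add: is_norm_scale[OF N] d_def)
    have "u * d \<le> d" "(1 - u) * d \<le> d" using u d by (simp_all add: mult_left_le_one_le)
    then have le: "N x \<le> 2 * d" "N y \<le> 2 * d" "N z \<le> 2 * d"
      using is_norm_diff_le[OF N, of x z] is_norm_diff_le[OF N, of y z] diff small d
      unfolding d_def[symmetric] by linarith+
    have \<phi>2: "\<phi> (2 * d) \<le> 4 * \<phi> d"
      using modulus_times_id_mult_le[OF \<omega>, of 2 d] d by (simp add: \<phi>_def)
    have "\<phi> (N x) - \<phi> (N z) \<le> 2 * \<omega> (2 * d) * \<bar>N x - N z\<bar>"
      unfolding \<phi>_def by (intro modulus_times_id_lipschitz[OF \<omega>] le is_norm_nonneg[OF N])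
    also have "\<dots> \<le> 2 * \<omega> (2 * d) * (u * d)"
      using is_norm_diff_le[OF N, of x z] diff moduli_nonneg[OF mod, of "2 * d"] d
      by (intro mult_left_mono) auto
    also have "\<dots> = u * \<phi> (2 * d)" by (simp add: \<phi>_def)
    finally have 1: "\<phi> (N x) - \<phi> (N z) \<le> u * \<phi> (2 * d)" .
    have 2: "u * \<phi> (N y) \<le> u * \<phi> (2 * d)"
      unfolding \<phi>_def using u le by (intro mult_left_mono modulus_times_id_mono[OF mod] is_norm_nonneg[OF N])
    have 3: "(1 - u) * \<phi> (N x) \<le> 1 * \<phi> (N x)"
      using u \<phi>0[OF is_norm_nonneg[OF N]] by (intro mult_right_mono) auto
    have "u * \<phi> (2 * d) \<le> u * (4 * \<phi> d)"
      using u \<phi>2 by (intro mult_left_mono) auto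
    then have "(1 - u) * \<phi> (N x) + u * \<phi> (N y) \<le> \<phi> (N z) + 8 * (u * \<phi> d)"
      using 1 2 3 by linarith
    also have "8 * (u * \<phi> d) \<le> 8 * (u * (2 * (1 - u)) * \<phi> d)"
      using u d \<phi>0[of d] mult_left_mono[of 1 "2 * (1 - u)" u]
      by (intro mult_left_mono mult_right_mono) auto
    also have "\<dots> = 16 * (u * (1 - u)) * \<phi> d" by simp
    finally show ?thesis by (simp add: d_def)
  qed
  have "(1 - u) * \<phi> (N x) + u * \<phi> (N y) \<le> \<phi> (N z) + (K + 16) * (u * (1 - u)) * \<phi> (N (x - y))"
    if u: "0 \<le> u" "u \<le> 1" and z: "z = (1 - u) *\<^sub>R x + u *\<^sub>R y" for x y z u
  proof -
    have nn: "0 \<le> u * (1 - u) * \<phi> (N (x - y))"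
      using u \<phi>0[OF is_norm_nonneg[OF N]] by simp
    have sym: "N (y - x) = N (x - y)" using is_norm_minus[OF N, of "x - y"] by simp
    consider (eq) "N (x - y) = 0" | (far) "0 < N (x - y)" "N (x - y) \<le> N z" | (near) "N z \<le> N (x - y)"
      using is_norm_nonneg[OF N, of "x - y"] by linarith
    then show ?thesis
    proof cases
      case eq
      then have "x = y" using is_norm_eq_zero[OF N, of "x - y"] by simp
      then have "z = x" by (simp add: z flip: scaleR_add_left)
      with \<open>x = y\<close> nn show ?thesis
        by (simp add: is_norm_zero[OF N] \<phi>_def algebra_simps)
    next
      case far
      from far_le[OF u z far] nn show ?thesis by (simp add: algebra_simps)
    next
      case near
      have "(1 - u) * \<phi> (N x) + u * \<phi> (N y) \<le> \<phi> (N z) + 16 * (u * (1 - u)) * \<phi> (N (x - y))"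
      proof (cases "u \<le> 1 / 2")
        case True
        with \<open>0 \<le> u\<close> show ?thesis using z near by (rule near_le)
      next
        case False
        have z': "z = (1 - (1 - u)) *\<^sub>R y + (1 - u) *\<^sub>R x"
          by (simp add: z add.commute)
        have "(1 - (1 - u)) * \<phi> (N y) + (1 - u) * \<phi> (N x)
            \<le> \<phi> (N z) + 16 * ((1 - u) * (1 - (1 - u))) * \<phi> (N (y - x))"
          using False u near by (intro near_le z') (auto simp: sym)
        then show ?thesis by (simp add: sym algebra_simps)
      qed
      moreover have "0 \<le> K * (u * (1 - u) * \<phi> (N (x - y)))" using K nn by simp
      ultimately show ?thesis by (simp add: algebra_simps)
    qed
  qed
  with that[of "K + 16"] K show ?thesis by (simp add: \<phi>_def)
qed

text \<open>
  The gauge is a multiple of \<open>N x * \<omega> (N x)\<close> for the smooth norm \<open>N\<close>; the factor pays for the passage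
  between the two equivalent norms.
\<close>
lemma smooth_gauge:
  fixes \<omega> :: "real \<Rightarrow> real" and N :: "'a::real_normed_vector \<Rightarrow> real"
  assumes \<omega>: "concave_modulus \<omega>" and N: "equivalent_norm N" and smooth: "smoothness_power_type N 2"
  obtains \<psi> :: "'a \<Rightarrow> real" and B C where
    "\<And>x. norm x * \<omega> (norm x) \<le> \<psi> x" "\<And>x. \<psi> x \<le> B * (norm x * \<omega> (norm x))" "B \<ge> 0"
    "C \<ge> 0" "paraconvex \<omega> C (\<lambda>x. - \<psi> x)"
proof -
  have mod: "\<omega> \<in> moduli" using \<omega> by (simp add: concave_modulus_def)
  have isN: "is_norm N" using N by (simp add: equivalent_norm_def)
  obtain a b where ab: "a > 0" "b > 0" "\<And>x. a * norm x \<le> N x" "\<And>x. N x \<le> b * norm x"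
    using N by (auto simp: equivalent_norm_def)
  define \<phi> where "\<phi> t = t * \<omega> t" for t
  define p q where "p = max 1 (1 / a)" and "q = max 1 b"
  have pq: "p \<ge> 1" "q \<ge> 1" by (auto simp: p_def q_def)
  have low: "\<phi> (norm x) \<le> p\<^sup>2 * \<phi> (N x)" for x
  proof -
    have "norm x \<le> (1 / a) * N x" using ab by (simp add: field_simps)
    also have "\<dots> \<le> p * N x" using is_norm_nonneg[OF isN] by (intro mult_right_mono) (auto simp: p_def)
    finally have "\<phi> (norm x) \<le> \<phi> (p * N x)"
      unfolding \<phi>_def by (intro modulus_times_id_mono[OF mod]) auto
    also have "\<dots> \<le> p\<^sup>2 * \<phi> (N x)"
      unfolding \<phi>_def using pq by (intro modulus_times_id_mult_le[OF \<omega>] is_norm_nonneg[OF isN])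
    finally show ?thesis .
  qed
  have up: "\<phi> (N x) \<le> q\<^sup>2 * \<phi> (norm x)" for x
  proof -
    have "N x \<le> q * norm x"
      using ab(4)[of x] mult_right_mono[of b q "norm x"] by (simp add: q_def)
    then have "\<phi> (N x) \<le> \<phi> (q * norm x)"
      unfolding \<phi>_def by (intro modulus_times_id_mono[OF mod] is_norm_nonneg[OF isN])
    also have "\<dots> \<le> q\<^sup>2 * \<phi> (norm x)"
      unfolding \<phi>_def using pq by (intro modulus_times_id_mult_le[OF \<omega>]) auto
    finally show ?thesis .
  qed
  obtain C where C: "C \<ge> 0" and sc: "\<And>x y u. 0 \<le> u \<Longrightarrow> u \<le> 1 \<Longrightarrow>
      (1 - u) * \<phi> (N x) + u * \<phi> (N y)
        \<le> \<phi> (N ((1 - u) *\<^sub>R x + u *\<^sub>R y)) + C * (u * (1 - u)) * \<phi> (N (x - y))"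
    using modulus_times_id_norm_semiconcave[OF \<omega> isN smooth] unfolding \<phi>_def by blast
  have para: "paraconvex \<omega> (p\<^sup>2 * C * q\<^sup>2) (\<lambda>x. - (p\<^sup>2 * \<phi> (N x)))"
    unfolding paraconvex_def
  proof (intro allI impI, elim conjE)
    fix x y :: 'a and u :: real
    assume u: "0 \<le> u" "u \<le> 1"
    have "p\<^sup>2 * ((1 - u) * \<phi> (N x) + u * \<phi> (N y))
        \<le> p\<^sup>2 * (\<phi> (N ((1 - u) *\<^sub>R x + u *\<^sub>R y)) + C * (u * (1 - u)) * \<phi> (N (x - y)))"
      using sc[OF u] by (intro mult_left_mono) auto
    also have "\<dots> \<le> p\<^sup>2 * (\<phi> (N ((1 - u) *\<^sub>R x + u *\<^sub>R y))
        + C * (u * (1 - u)) * (q\<^sup>2 * \<phi> (norm (x - y))))"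
      using u C by (intro mult_left_mono add_left_mono up) auto
    finally show "- (p\<^sup>2 * \<phi> (N ((1 - u) *\<^sub>R x + u *\<^sub>R y)))
        \<le> (1 - u) * - (p\<^sup>2 * \<phi> (N x)) + u * - (p\<^sup>2 * \<phi> (N y))
          + p\<^sup>2 * C * q\<^sup>2 * (u * (1 - u)) * (norm (x - y) * \<omega> (norm (x - y)))"
      unfolding \<phi>_def[of "norm (x - y)", symmetric] by (simp add: algebra_simps)
  qed
  show ?thesis
  proof (rule that)
    show "norm x * \<omega> (norm x) \<le> p\<^sup>2 * \<phi> (N x)" for x
      using low[of x] by (simp add: \<phi>_def)
    show "p\<^sup>2 * \<phi> (N x) \<le> p\<^sup>2 * q\<^sup>2 * (norm x * \<omega> (norm x))" for x
      using mult_left_mono[OF up[of x], of "p\<^sup>2"] by (simp add: \<phi>_def mult.assoc)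
  qed (use C para in auto)
qed

section \<open>Extension of jets\<close>

text \<open>
  A Whitney extension theorem: the set \<open>E\<close> is arbitrary.  The functions \<open>lo y\<close> and \<open>- up y\<close>
  are the first-order expansions of \<open>f\<close> at \<open>y\<close>, bent down and up by the gauge.
\<close>
theorem C1_omega_jet_extension:
  fixes N f :: "'a::real_normed_vector \<Rightarrow> real" and G :: "'a \<Rightarrow> 'a \<Rightarrow> real"
  assumes \<omega>: "concave_modulus \<omega>" and N: "equivalent_norm N" and smooth: "smoothness_power_type N 2"
    and "E \<noteq> {}" and "A \<ge> 0"
    and bl: "\<And>y. y \<in> E \<Longrightarrow> bounded_linear (G y)"
    and taylor: "\<And>x y. x \<in> E \<Longrightarrow> y \<in> E \<Longrightarrow>
      \<bar>f y - f x - G x (y - x)\<bar> \<le> A * (norm (x - y) * \<omega> (norm (x - y)))"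
    and G: "\<And>x y h. x \<in> E \<Longrightarrow> y \<in> E \<Longrightarrow> \<bar>G x h - G y h\<bar> \<le> A * \<omega> (norm (x - y)) * norm h"
  obtains F where "F \<in> C1_omega \<omega> UNIV" "\<And>x. x \<in> E \<Longrightarrow> F x = f x"
proof -
  have mod: "\<omega> \<in> moduli" using \<omega> by (simp add: concave_modulus_def)
  obtain \<psi> :: "'a \<Rightarrow> real" and B C where
    \<psi>: "\<And>x. norm x * \<omega> (norm x) \<le> \<psi> x" "\<And>x. \<psi> x \<le> B * (norm x * \<omega> (norm x))" and B: "B \<ge> 0"
    and C: "C \<ge> 0" "paraconvex \<omega> C (\<lambda>x. - \<psi> x)"
    using smooth_gauge[OF \<omega> N smooth] by blast
  \<comment> \<open>in \<open>key\<close> below, the Taylor remainder costs \<open>4 * A\<close> and the change of gradient \<open>2 * A\<close>\<close>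
  define M where "M = 6 * A"
  have M: "M \<ge> 0" using \<open>A \<ge> 0\<close> by (simp add: M_def)
  define lo up where "lo y x = f y + G y (x - y) + M * - \<psi> (x - y)"
    and "up y x = - f y + - G y (x - y) + M * - \<psi> (x - y)" for x y
  have linG: "linear (G y)" "linear (\<lambda>h. - G y h)" if "y \<in> E" for y
    using bl[OF that] by (simp_all add: bounded_linear.linear linear_compose_neg)
  have para: "paraconvex \<omega> (M * C) (lo y)" "paraconvex \<omega> (M * C) (up y)" if "y \<in> E" for y
    using paraconvex_affine_translate[OF C(2) linG(1)[OF that] M, of "f y" y]
      paraconvex_affine_translate[OF C(2) linG(2)[OF that] M, of "- f y" y]
    by (simp_all add: lo_def[abs_def] up_def[abs_def])
  have key: "lo y x \<le> - up z x" if yz: "y \<in> E" "z \<in> E" for x y z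
  proof -
    \<comment> \<open>one of \<open>y\<close>, \<open>z\<close> has distance at least \<open>d / 2\<close> from \<open>x\<close>, so that one gauge term alone suffices\<close>
    define d r where "d = norm (y - z)" and "r = max (norm (x - y)) (norm (x - z))"
    have "d \<le> norm (x - z) + norm (x - y)"
      unfolding d_def using norm_triangle_ineq4[of "x - z" "x - y"] by (simp add: algebra_simps)
    then have d: "0 \<le> d" "d \<le> 2 * r" and r: "0 \<le> r" "norm (x - y) \<le> r"
      by (auto simp: d_def r_def intro: max.coboundedI1)
    have \<omega>d: "\<omega> d \<le> 2 * \<omega> r" "0 \<le> \<omega> d"
      using moduli_mono[OF mod d] concave_modulus_mult_le[OF \<omega>, of 2 r] r moduli_nonneg[OF mod d(1)]
      by auto
    have "f y - f z - G z (y - z) \<le> A * (d * \<omega> d)"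
      using taylor[OF yz(2,1)] by (simp add: d_def norm_minus_commute abs_le_iff)
    also have "\<dots> \<le> A * ((2 * r) * (2 * \<omega> r))"
      using \<open>A \<ge> 0\<close> d \<omega>d r by (intro mult_left_mono mult_mono) auto
    finally have 1: "f y - f z - G z (y - z) \<le> A * (4 * (r * \<omega> r))" by simp
    have "G y (x - y) - G z (x - y) \<le> A * \<omega> d * norm (x - y)"
      using G[OF yz, of "x - y"] by (simp add: d_def abs_le_iff)
    also have "\<dots> \<le> A * (2 * \<omega> r) * r"
      using \<open>A \<ge> 0\<close> \<omega>d r moduli_nonneg[OF mod r(1)] by (intro mult_mono) auto
    finally have 2: "G y (x - y) - G z (x - y) \<le> A * (2 * (r * \<omega> r))" by (simp add: mult_ac)
    have "G z (x - z) = G z (x - y) + G z (y - z)"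
      using linear_add[OF linG(1)[OF yz(2)], of "x - y" "y - z"] by simp
    with 1 2 have "f y + G y (x - y) - (f z + G z (x - z)) \<le> M * (r * \<omega> r)"
      by (simp add: M_def)
    also have "r * \<omega> r \<le> norm (x - y) * \<omega> (norm (x - y)) + norm (x - z) * \<omega> (norm (x - z))"
      using moduli_nonneg[OF mod] by (simp add: r_def max_def)
    also have "\<dots> \<le> \<psi> (x - y) + \<psi> (x - z)"
      by (intro add_mono \<psi>)
    finally have "f y + G y (x - y) - (f z + G z (x - z)) \<le> M * (\<psi> (x - y) + \<psi> (x - z))"
      using M by (simp add: mult_left_mono)
    then show ?thesis by (simp add: lo_def up_def algebra_simps)
  qed
  obtain e where e: "e \<in> E" using \<open>E \<noteq> {}\<close> by blast
  \<comment> \<open>the upper bound is written as a negated supremum so that closure of paraconvexity under suprema serves both\<close>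
  define l g where "l x = (SUP y\<in>E. lo y x)" and "g x = - (SUP y\<in>E. up y x)" for x
  have bdd: "bdd_above ((\<lambda>y. lo y x) ` E)" "bdd_above ((\<lambda>y. up y x) ` E)" for x
  proof -
    show "bdd_above ((\<lambda>y. lo y x) ` E)"
      using key[OF _ e, of _ x] by (intro bdd_aboveI[of _ "- up e x"]) auto
    show "bdd_above ((\<lambda>y. up y x) ` E)"
      using key[OF e, of _ x] by (intro bdd_aboveI[of _ "- lo e x"]) (auto simp: le_minus_iff)
  qed
  have lo_le: "lo y x \<le> l x" if "y \<in> E" for x y
    unfolding l_def using that bdd by (intro cSUP_upper)
  have g_le: "g x \<le> - up y x" if "y \<in> E" for x y
    unfolding g_def neg_le_iff_le using that bdd by (intro cSUP_upper)
  have lg: "l x \<le> g x" for x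
  proof -
    have "(SUP z\<in>E. up z x) \<le> - lo y x" if "y \<in> E" for y
      using key[OF that, of _ x] \<open>E \<noteq> {}\<close> by (intro cSUP_least) (auto simp: le_minus_iff)
    then have "lo y x \<le> g x" if "y \<in> E" for y
      using that by (simp add: g_def le_minus_iff)
    then show ?thesis
      unfolding l_def using \<open>E \<noteq> {}\<close> by (intro cSUP_least)
  qed
  have l: "paraconvex \<omega> (M * C) l"
    unfolding l_def by (rule paraconvex_SUP[OF \<open>E \<noteq> {}\<close> bdd(1) para(1)])
  have g: "paraconvex \<omega> (M * C) (\<lambda>x. - g x)"
    unfolding g_def minus_minus by (rule paraconvex_SUP[OF \<open>E \<noteq> {}\<close> bdd(2) para(2)])
  obtain F where lF: "\<And>x. l x \<le> F x" and Fg: "\<And>x. F x \<le> g x"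
    and F: "paraconvex \<omega> (M * C) F" "paraconvex \<omega> (M * C) (\<lambda>x. - F x)"
    by (fact paraconvex_insertion[OF l g lg])
  have between: "lo y x \<le> F x" "F x \<le> - up y x" if "y \<in> E" for x y
    using order_trans[OF lo_le[OF that] lF] order_trans[OF Fg g_le[OF that]] by auto
  have "F \<in> C1_omega \<omega> UNIV"
  proof (rule paraconvex_both_imp_C1[OF \<omega> _ F])
    show "M * C \<ge> 0" using M C by simp
    fix x
    obtain K where K: "\<And>h. norm (G e h) \<le> norm h * K" and "K > 0"
      using bounded_linear.pos_bounded[OF bl[OF e]] by blast
    define R where "R = norm (x - e) + 1"
    have "\<bar>F (x + h)\<bar> \<le> \<bar>f e\<bar> + R * K + M * (B * (R * \<omega> R))" if h: "norm h \<le> 1" for h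
    proof -
      have R: "norm (x + h - e) \<le> R"
        using norm_triangle_ineq[of "x - e" h] h by (simp add: R_def algebra_simps)
      have "\<bar>G e (x + h - e)\<bar> \<le> R * K"
        using order_trans[OF K mult_right_mono[OF R less_imp_le[OF \<open>K > 0\<close>]]] by simp
      moreover have "M * \<psi> (x + h - e) \<le> M * (B * (R * \<omega> R))"
      proof (rule mult_left_mono[OF _ M])
        have "\<psi> (x + h - e) \<le> B * (norm (x + h - e) * \<omega> (norm (x + h - e)))"
          by (rule \<psi>)
        also have "\<dots> \<le> B * (R * \<omega> R)"
          using R by (intro mult_left_mono modulus_times_id_mono[OF mod] B) auto
        finally show "\<psi> (x + h - e) \<le> B * (R * \<omega> R)" .
      qed
      ultimately show ?thesis
        using between[OF e, of "x + h"] unfolding lo_def up_def by linarith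
    qed
    then show "\<exists>B. \<forall>h. norm h \<le> 1 \<longrightarrow> \<bar>F (x + h)\<bar> \<le> B" by blast
  qed
  moreover have "F x = f x" if "x \<in> E" for x
  proof -
    have "\<psi> 0 = 0" using \<psi>[of 0] by simp
    then show ?thesis
      using between[OF that, of x] linear_0[OF linG(1)[OF that]] by (simp add: lo_def up_def)
  qed
  ultimately show ?thesis using that by blast
qed

section \<open>Quasiconvex sets\<close>

text \<open>
  The polygonal sums of \<open>curve_length\<close>, in the recursive form that suits the induction in which
  chains are merged.
\<close>
fun chain_length :: "'a::metric_space list \<Rightarrow> real" where
  "chain_length (x # y # zs) = dist x y + chain_length (y # zs)"
| "chain_length _ = 0"

lemma chain_length_nonneg: "0 \<le> chain_length xs"
  by (induction xs rule: chain_length.induct) auto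

lemma chain_length_conv_sum: "chain_length xs = (\<Sum>i<length xs - 1. dist (xs ! i) (xs ! Suc i))"
proof (induction xs rule: chain_length.induct)
  case (1 x y zs)
  then show ?case by (simp add: sum.lessThan_Suc_shift del: sum.lessThan_Suc)
qed auto

lemma chain_length_le_curve_length:
  assumes "curve_length \<gamma> \<le> ereal L" "sorted ts" "set ts \<subseteq> {0..1}"
  shows "chain_length (map \<gamma> ts) \<le> L"
proof -
  have "ereal (\<Sum>i<length ts - 1. dist (\<gamma> (ts ! i)) (\<gamma> (ts ! Suc i))) \<le> curve_length \<gamma>"
    unfolding curve_length_def using assms by (intro SUP_upper) auto
  also note assms(1)
  finally show ?thesis by (simp add: chain_length_conv_sum)
qed

text \<open>
  Sample a short curve finely enough that consecutive points lie in a common ball inside \<open>U\<close>.  The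
  segments stay in \<open>cball x (c * dist x y)\<close> because the partition consisting of \<open>0\<close> and two consecutive
  parameters already gives a polygonal sum that is bounded by the length of the curve.
\<close>
lemma quasiconvex_chain:
  fixes U :: "'a::real_normed_vector set"
  assumes "open U" "c_quasiconvex c U" "x \<in> U" "y \<in> U" "\<epsilon> > 0"
  obtains ps where "ps \<noteq> []" "hd ps = x" "last ps = y" "set ps \<subseteq> U" "chain_length ps \<le> c * dist x y"
    "successively (\<lambda>a b. dist a b < \<epsilon> \<and> closed_segment a b \<subseteq> U \<inter> cball x (c * dist x y)) ps"
proof -
  obtain \<gamma> where path: "path \<gamma>" and im: "path_image \<gamma> \<subseteq> U"
    and ends: "pathstart \<gamma> = x" "pathfinish \<gamma> = y"
    and len: "curve_length \<gamma> \<le> ereal (c * dist x y)"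
    using assms unfolding c_quasiconvex_def by blast
  obtain e where e: "e > 0" "(\<Union>z\<in>path_image \<gamma>. ball z e) \<subseteq> U"
    using compact_subset_open_imp_ball_epsilon_subset[OF compact_path_image[OF path] \<open>open U\<close> im] by blast
  have "uniformly_continuous_on {0..1} \<gamma>"
    using path by (auto simp: path_def intro: compact_uniformly_continuous)
  moreover have "min e \<epsilon> > 0" using e \<open>\<epsilon> > 0\<close> by simp
  ultimately obtain d where d: "d > 0"
    "\<And>s t. s \<in> {0..1} \<Longrightarrow> t \<in> {0..1} \<Longrightarrow> dist t s < d \<Longrightarrow> dist (\<gamma> t) (\<gamma> s) < min e \<epsilon>"
    unfolding uniformly_continuous_on_def by metis
  obtain n where n: "n > 0" "inverse (real n) < d"
    using d(1) ex_inverse_of_nat_less by blast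
  define ts where "ts = map (\<lambda>i. real i / real n) [0..<Suc n]"
  have set_ts: "set ts \<subseteq> {0..1}" using n by (auto simp: ts_def)
  have sorted_ts: "sorted ts"
    unfolding ts_def sorted_map
    by (rule sorted_wrt_mono_rel[of _ "(\<le>)"]) (auto simp: divide_right_mono simp del: upt_Suc)
  have start: "\<gamma> 0 = x" "\<gamma> 1 = y" using ends by (auto simp: pathstart_def pathfinish_def)
  show ?thesis
  proof (rule that)
    show "map \<gamma> ts \<noteq> []" "hd (map \<gamma> ts) = x" "last (map \<gamma> ts) = y"
      using n start by (auto simp: ts_def hd_map last_map hd_upt simp del: upt_Suc)
    show "set (map \<gamma> ts) \<subseteq> U"
      using set_ts im by (auto simp: path_image_def)
    show "chain_length (map \<gamma> ts) \<le> c * dist x y"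
      by (rule chain_length_le_curve_length[OF len sorted_ts set_ts])
    show "successively (\<lambda>a b. dist a b < \<epsilon> \<and> closed_segment a b \<subseteq> U \<inter> cball x (c * dist x y)) (map \<gamma> ts)"
      unfolding successively_conv_nth
    proof (intro allI impI)
      fix i assume i: "Suc i < length (map \<gamma> ts)"
      define s t where "s = real i / real n" and "t = real (Suc i) / real n"
      have st: "0 \<le> s" "s \<le> t" "t \<le> 1" "dist s t < d"
        using n i by (auto simp: s_def t_def ts_def field_simps dist_real_def)
      have nth: "map \<gamma> ts ! i = \<gamma> s" "map \<gamma> ts ! Suc i = \<gamma> t"
        using i by (simp_all add: ts_def s_def t_def del: upt_Suc)
      have close: "dist (\<gamma> s) (\<gamma> t) < min e \<epsilon>" using st by (intro d) auto
      have "closed_segment (\<gamma> s) (\<gamma> t) \<subseteq> ball (\<gamma> s) e"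
        using close e(1) by (intro closed_segment_subset) auto
      also have "\<dots> \<subseteq> U" using e(2) st by (force simp: path_image_def)
      finally have U: "closed_segment (\<gamma> s) (\<gamma> t) \<subseteq> U" .
      have "chain_length (map \<gamma> [0, s, t]) \<le> c * dist x y"
        using st by (intro chain_length_le_curve_length[OF len]) auto
      then have "dist x (\<gamma> s) + dist (\<gamma> s) (\<gamma> t) \<le> c * dist x y"
        by (simp add: start)
      then have "dist x z \<le> c * dist x y" if "z \<in> closed_segment (\<gamma> s) (\<gamma> t)" for z
        using closed_segment_subset[of "\<gamma> s" "cball (\<gamma> s) (dist (\<gamma> s) (\<gamma> t))" "\<gamma> t"] that
          dist_triangle[of x z "\<gamma> s"] by fastforce
      then have "closed_segment (\<gamma> s) (\<gamma> t) \<subseteq> cball x (c * dist x y)" by auto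
      with U close show "dist (map \<gamma> ts ! i) (map \<gamma> ts ! Suc i) < \<epsilon>
          \<and> closed_segment (map \<gamma> ts ! i) (map \<gamma> ts ! Suc i) \<subseteq> U \<inter> cball x (c * dist x y)"
        unfolding nth by auto
    qed
  qed
qed

lemma chain_lipschitz:
  fixes h :: "'a::metric_space \<Rightarrow> real"
  assumes "ps \<noteq> []" "successively (\<lambda>a b. \<bar>h b - h a\<bar> \<le> B * dist a b) ps"
  shows "\<bar>h (last ps) - h (hd ps)\<bar> \<le> B * chain_length ps"
  using assms
proof (induction ps rule: chain_length.induct)
  case (1 x y zs)
  then show ?case by (auto simp: algebra_simps)
qed auto

text \<open>
  Merge two consecutive steps whenever their total length is at most \<open>t\<close>.  When this is no longer
  possible, any two consecutive steps use up length at least \<open>t\<close>, so that a pair of steps, which costs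
  \<open>2 * w\<close>, is paid for by the decrease of \<open>2 * chain_length / t\<close>; a possible last single step
  gives the summand \<open>1\<close>.
\<close>
lemma chain_merging:
  fixes D :: "'a::metric_space \<Rightarrow> 'a \<Rightarrow> real"
  assumes t: "t > 0" and w: "w \<ge> 0"
    and small: "\<And>x y. x \<in> U \<Longrightarrow> y \<in> U \<Longrightarrow> dist x y \<le> t \<Longrightarrow> D x y \<le> w"
    and tri: "\<And>x y z. x \<in> U \<Longrightarrow> y \<in> U \<Longrightarrow> z \<in> U \<Longrightarrow> D x z \<le> D x y + D y z"
    and ps: "ps \<noteq> []" "set ps \<subseteq> U" "successively (\<lambda>a b. dist a b \<le> t) ps"
  shows "D (hd ps) (last ps) \<le> (2 * chain_length ps / t + 1) * w"
  using ps
proof (induction ps rule: length_induct)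
  case (1 ps)
  show ?case
  proof (cases ps rule: remdups_adj.cases)
    case 1
    with "1.prems" show ?thesis by simp
  next
    case (2 a)
    with "1.prems" small[of a a] t show ?thesis by simp
  next
    case (3 a b qs)
    show ?thesis
    proof (cases qs)
      case Nil
      have "D a b \<le> w" using "1.prems" 3 Nil by (intro small) auto
      also have "\<dots> \<le> (2 * dist a b / t + 1) * w"
        using t w by (simp add: algebra_simps)
      finally show ?thesis using 3 Nil by simp
    next
      case (Cons c rs)
      have U: "a \<in> U" "b \<in> U" "c \<in> U" "last (c # rs) \<in> U"
        using "1.prems" 3 Cons last_in_set[of "c # rs"] by (auto simp del: last.simps)
      have len: "chain_length ps = dist a b + dist b c + chain_length (c # rs)"
        using 3 Cons by simp
      show ?thesis
      proof (cases "dist a b + dist b c \<le> t")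
        case True
        have ac: "dist a c \<le> dist a b + dist b c" by (rule dist_triangle)
        have "D (hd (a # c # rs)) (last (a # c # rs)) \<le> (2 * chain_length (a # c # rs) / t + 1) * w"
          using "1.prems" 3 Cons True ac by (intro "1.IH"[rule_format]) auto
        also have "\<dots> \<le> (2 * chain_length ps / t + 1) * w"
          using t w ac by (intro mult_right_mono add_right_mono divide_right_mono) (auto simp: len)
        finally show ?thesis using 3 Cons by simp
      next
        case False
        have "D (hd (c # rs)) (last (c # rs)) \<le> (2 * chain_length (c # rs) / t + 1) * w"
          using "1.prems" 3 Cons by (intro "1.IH"[rule_format]) auto
        moreover have "D a c \<le> 2 * w"
          using tri[OF U(1,2,3)] small[OF U(1,2)] small[OF U(2,3)] "1.prems" 3 Cons by auto
        ultimately have "D a (last (c # rs)) \<le> (2 * chain_length (c # rs) / t + 3) * w"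
          using tri[OF U(1,3,4)] by (simp add: algebra_simps)
        also have "\<dots> \<le> (2 * chain_length ps / t + 1) * w"
        proof (rule mult_right_mono[OF _ w])
          have "2 * t + 2 * chain_length (c # rs) \<le> 2 * chain_length ps"
            using False by (simp add: len)
          then have "(2 * t + 2 * chain_length (c # rs)) / t \<le> 2 * chain_length ps / t"
            using t by (intro divide_right_mono) auto
          then show "2 * chain_length (c # rs) / t + 3 \<le> 2 * chain_length ps / t + 1"
            using t by (simp add: add_divide_distrib)
        qed
        finally show ?thesis using 3 Cons by simp
      qed
    qed
  qed
qed

text \<open>
  Let \<open>\<omega>1 t\<close> be the supremum of \<open>D x y\<close> over \<open>dist x y \<le> t\<close>.  Cutting a chain into steps
  of length about \<open>t\<close> gives \<open>D x y \<le> (2 * c * dist x y / t + 1) * \<omega>1 t\<close> for every \<open>t\<close>.  The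
  infimum over \<open>t\<close> of the right-hand side is an infimum of affine functions of the distance, hence concave, and the choice
  \<open>t = s\<close> shows that it is at most \<open>(2 * c + 1) * \<omega>1 s\<close>.
\<close>
lemma quasiconvex_concave_majorant:
  fixes U :: "'a::real_normed_vector set" and D :: "'a \<Rightarrow> 'a \<Rightarrow> real"
  assumes "open U" and qc: "c_quasiconvex c U" and ne: "U \<noteq> {}"
    and \<omega>: "\<omega> \<in> moduli" and C: "C \<ge> 0"
    and tri: "\<And>x y z. x \<in> U \<Longrightarrow> y \<in> U \<Longrightarrow> z \<in> U \<Longrightarrow> D x z \<le> D x y + D y z"
    and nonneg: "\<And>x y. x \<in> U \<Longrightarrow> y \<in> U \<Longrightarrow> 0 \<le> D x y"
    and le: "\<And>x y. x \<in> U \<Longrightarrow> y \<in> U \<Longrightarrow> D x y \<le> C * \<omega> (dist x y)"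
  obtains \<omega>' K where "concave_modulus \<omega>'" "K \<ge> 0" "\<And>s. s \<ge> 0 \<Longrightarrow> \<omega>' s \<le> K * \<omega> s"
    "\<And>x y. x \<in> U \<Longrightarrow> y \<in> U \<Longrightarrow> D x y \<le> \<omega>' (dist x y)"
proof -
  have c: "c \<ge> 1" using qc by (simp add: c_quasiconvex_def)
  define P where "P t = {(x, y). x \<in> U \<and> y \<in> U \<and> dist x y \<le> t}" for t
  define \<omega>1 where "\<omega>1 t = (SUP (x, y)\<in>P t. D x y)" for t
  have bdd: "bdd_above ((\<lambda>(x, y). D x y) ` P t)" for t
  proof (rule bdd_aboveI[of _ "C * \<omega> \<bar>t\<bar>"], clarify)
    fix x y assume "(x, y) \<in> P t"
    then show "D x y \<le> C * \<omega> \<bar>t\<bar>"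
      using le[of x y] mult_left_mono[OF moduli_mono[OF \<omega>, of "dist x y" "\<bar>t\<bar>"] C] abs_ge_self[of t]
      by (auto simp: P_def intro: order_trans)
  qed
  have upper: "D x y \<le> \<omega>1 t" if "x \<in> U" "y \<in> U" "dist x y \<le> t" for x y t
    unfolding \<omega>1_def using that cSUP_upper[OF _ bdd, of "(x, y)" t] by (simp add: P_def)
  have \<omega>1_le: "\<omega>1 t \<le> C * \<omega> t" if "t \<ge> 0" for t
    unfolding \<omega>1_def
  proof (rule cSUP_least)
    obtain u where "u \<in> U" using ne by blast
    with that have "(u, u) \<in> P t" by (simp add: P_def)
    then show "P t \<noteq> {}" by blast
    fix p assume "p \<in> P t"
    then show "(case p of (x, y) \<Rightarrow> D x y) \<le> C * \<omega> t"
      using le[of "fst p" "snd p"] mult_left_mono[OF moduli_mono[OF \<omega>, of "dist (fst p) (snd p)" t] C]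
      by (auto simp: P_def)
  qed
  have \<omega>1_nonneg: "0 \<le> \<omega>1 t" if "t > 0" for t
  proof -
    obtain u where "u \<in> U" using ne by blast
    then show ?thesis using nonneg[of u u] upper[of u u t] that by simp
  qed
  have step: "D x y \<le> (2 * c * dist x y / t + 1) * \<omega>1 t" if xy: "x \<in> U" "y \<in> U" and t: "t > 0" for x y t
  proof -
    obtain ps where ps: "ps \<noteq> []" "hd ps = x" "last ps = y" "set ps \<subseteq> U" "chain_length ps \<le> c * dist x y"
      "successively (\<lambda>a b. dist a b < t \<and> closed_segment a b \<subseteq> U \<inter> cball x (c * dist x y)) ps"
      using quasiconvex_chain[OF \<open>open U\<close> qc xy t] by blast
    have "successively (\<lambda>a b. dist a b \<le> t) ps"
      using ps(6) by (rule successively_mono) auto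
    then have "D x y \<le> (2 * chain_length ps / t + 1) * \<omega>1 t"
      using chain_merging[OF t \<omega>1_nonneg[OF t] upper tri ps(1,4)] ps(2,3) by simp
    also have "\<dots> \<le> (2 * (c * dist x y) / t + 1) * \<omega>1 t"
      using t ps(5) \<omega>1_nonneg[OF t] by (intro mult_right_mono add_right_mono divide_right_mono) auto
    finally show ?thesis by (simp add: mult.assoc)
  qed
  \<comment> \<open>affine in \<open>s\<close> with nonnegative coefficients for each fixed \<open>t\<close>\<close>
  define \<omega>' where "\<omega>' s = (INF t\<in>{0<..}. (2 * c * s / t + 1) * \<omega>1 t)" for s
  have below: "bdd_below ((\<lambda>t. (2 * c * s / t + 1) * \<omega>1 t) ` {0<..})" if "s \<ge> 0" for s
    using that c \<omega>1_nonneg by (auto intro!: bdd_belowI[of _ 0] mult_nonneg_nonneg add_nonneg_nonneg)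
  have lower: "\<omega>' s \<le> (2 * c * s / t + 1) * \<omega>1 t" if "s \<ge> 0" "t > 0" for s t
    unfolding \<omega>'_def using that by (intro cINF_lower below) auto
  have nn: "0 \<le> \<omega>' s" if "s \<ge> 0" for s
    unfolding \<omega>'_def using that c \<omega>1_nonneg
    by (intro cINF_greatest mult_nonneg_nonneg add_nonneg_nonneg) auto
  \<comment> \<open>at \<open>s = 0\<close> the infimum is that of \<open>\<omega>1\<close>, which vanishes only by continuity of \<open>\<omega>\<close> at \<open>0\<close>\<close>
  have zero: "\<omega>' 0 = 0"
  proof -
    have "((\<lambda>t. C * \<omega> \<bar>t\<bar>) \<longlongrightarrow> 0) (at_right (0::real))"
      by (intro tendsto_mult_right_zero moduli_tendsto_zero[OF \<omega>] tendsto_rabs_zero tendsto_ident_at) auto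
    moreover have "\<forall>\<^sub>F t in at_right 0. \<omega>' 0 \<le> C * \<omega> \<bar>t\<bar>"
      using eventually_at_right_less
    proof eventually_elim
      case (elim t)
      then show ?case using lower[of 0 t] \<omega>1_le[of t] by simp
    qed
    ultimately have "\<omega>' 0 \<le> 0"
      by (rule tendsto_lowerbound) auto
    with nn[of 0] show ?thesis by simp
  qed
  have bound: "\<omega>' s \<le> ((2 * c + 1) * C) * \<omega> s" if "s \<ge> 0" for s
  proof (cases "s = 0")
    case False
    have "\<omega>' s \<le> (2 * c + 1) * \<omega>1 s" using lower[of s s] that False by simp
    also have "\<dots> \<le> (2 * c + 1) * (C * \<omega> s)" using \<omega>1_le[OF that] c by (intro mult_left_mono) auto
    finally show ?thesis by simp
  qed (simp add: zero moduli_zero[OF \<omega>])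
  have "mono_on {0..} \<omega>'"
  proof (rule mono_onI)
    fix r s :: real assume rs: "r \<in> {0..}" "s \<in> {0..}" "r \<le> s"
    then show "\<omega>' r \<le> \<omega>' s"
      unfolding \<omega>'_def
    proof (intro cINF_mono below)
      fix t :: real assume t: "t \<in> {0<..}"
      have "(2 * c * r / t + 1) * \<omega>1 t \<le> (2 * c * s / t + 1) * \<omega>1 t"
        using t rs c \<omega>1_nonneg[of t]
        by (intro mult_right_mono add_right_mono divide_right_mono mult_left_mono) auto
      then show "\<exists>t'\<in>{0<..}. (2 * c * r / t' + 1) * \<omega>1 t' \<le> (2 * c * s / t + 1) * \<omega>1 t"
        using t by blast
    qed auto
  qed
  moreover have "continuous (at 0 within {0..}) \<omega>'"
  proof -
    have "continuous (at 0 within {0..}) \<omega>" using \<omega> by (simp add: moduli_def)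
    then have "(\<omega> \<longlongrightarrow> 0) (at 0 within {0..})"
      unfolding continuous_within by (simp only: moduli_zero[OF \<omega>])
    then have lim: "((\<lambda>s. (2 * c + 1) * C * \<omega> s) \<longlongrightarrow> 0) (at 0 within {0..})"
      by (rule tendsto_mult_right_zero)
    have "(\<omega>' \<longlongrightarrow> 0) (at 0 within {0..})"
    proof (rule tendsto_sandwich[OF _ _ tendsto_const lim])
      show "\<forall>\<^sub>F s in at 0 within {0..}. 0 \<le> \<omega>' s"
        using nn by (simp add: eventually_at_filter)
      show "\<forall>\<^sub>F s in at 0 within {0..}. \<omega>' s \<le> (2 * c + 1) * C * \<omega> s"
        using bound by (simp add: eventually_at_filter)
    qed
    then show ?thesis unfolding continuous_within by (simp only: zero)
  qed
  moreover have "concave_on {0..} \<omega>'"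
    unfolding concave_on_iff
  proof (intro conjI ballI allI impI)
    fix x y u v :: real assume xy: "x \<in> {0..}" "y \<in> {0..}" and uv: "0 \<le> u" "0 \<le> v" "u + v = 1"
    show "u * \<omega>' x + v * \<omega>' y \<le> \<omega>' (u *\<^sub>R x + v *\<^sub>R y)"
      unfolding \<omega>'_def[of "u *\<^sub>R x + v *\<^sub>R y"]
    proof (rule cINF_greatest)
      fix t :: real assume "t \<in> {0<..}"
      then have "u * \<omega>' x + v * \<omega>' y
          \<le> u * ((2 * c * x / t + 1) * \<omega>1 t) + v * ((2 * c * y / t + 1) * \<omega>1 t)"
        using xy uv by (intro add_mono mult_left_mono lower) auto
      also have "\<dots> = (2 * c * (u * x + v * y) / t + (u + v)) * \<omega>1 t"
        by (simp add: add_divide_distrib algebra_simps)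
      finally show "u * \<omega>' x + v * \<omega>' y \<le> (2 * c * (u *\<^sub>R x + v *\<^sub>R y) / t + 1) * \<omega>1 t"
        using uv by simp
    qed auto
  qed (rule convex_real_interval)
  ultimately have "concave_modulus \<omega>'"
    unfolding concave_modulus_def moduli_def using nn zero by auto
  moreover have "D x y \<le> \<omega>' (dist x y)" if "x \<in> U" "y \<in> U" for x y
    unfolding \<omega>'_def using step[OF that] by (intro cINF_greatest) auto
  moreover have "(2 * c + 1) * C \<ge> 0" using c C by simp
  ultimately show ?thesis using that bound by blast
qed

text \<open>
  Apply the mean value inequality to \<open>f - f' x\<close> on each segment of a chain from \<open>x\<close> to \<open>y\<close>: all
  these segments lie in \<open>U\<close> within distance \<open>c * dist x y\<close> of \<open>x\<close>.
\<close>
lemma quasiconvex_taylor: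
  fixes U :: "'a::real_normed_vector set" and f :: "'a \<Rightarrow> real"
  assumes "open U" and qc: "c_quasiconvex c U" and \<omega>: "\<omega> \<in> moduli"
    and f': "\<And>x. x \<in> U \<Longrightarrow> (f has_derivative f' x) (at x)"
    and mod: "\<And>x y. x \<in> U \<Longrightarrow> y \<in> U \<Longrightarrow> onorm (\<lambda>h. f' x h - f' y h) \<le> \<omega> (dist x y)"
    and xy: "x \<in> U" "y \<in> U"
  shows "\<bar>f y - f x - f' x (y - x)\<bar> \<le> \<omega> (c * dist x y) * (c * dist x y)"
proof -
  have c: "c \<ge> 1" using qc by (simp add: c_quasiconvex_def)
  have cd: "0 \<le> c * dist x y" using c by simp
  obtain ps where ps: "ps \<noteq> []" "hd ps = x" "last ps = y" "set ps \<subseteq> U" "chain_length ps \<le> c * dist x y"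
    "successively (\<lambda>a b. dist a b < 1 \<and> closed_segment a b \<subseteq> U \<inter> cball x (c * dist x y)) ps"
    using quasiconvex_chain[OF \<open>open U\<close> qc xy zero_less_one] by blast
  have lin: "bounded_linear (f' x)" using f'[OF xy(1)] by (rule has_derivative_bounded_linear)
  define h where "h z = f z - f' x z" for z
  have "\<bar>h b - h a\<bar> \<le> \<omega> (c * dist x y) * dist a b"
    if seg: "closed_segment a b \<subseteq> U \<inter> cball x (c * dist x y)" for a b
  proof -
    have "norm (h b - h a) \<le> \<omega> (c * dist x y) * norm (b - a)"
    proof (rule differentiable_bound[of "closed_segment a b" h "\<lambda>z k. f' z k - f' x k"])
      fix z assume "z \<in> closed_segment a b"
      then have z: "z \<in> U" "dist z x \<le> c * dist x y" using seg by (auto simp: dist_commute)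
      show "(h has_derivative (\<lambda>k. f' z k - f' x k)) (at z within closed_segment a b)"
        unfolding h_def
        by (intro has_derivative_diff has_derivative_at_withinI[OF f'[OF z(1)]]
            bounded_linear.has_derivative[OF lin] has_derivative_ident)
      show "onorm (\<lambda>k. f' z k - f' x k) \<le> \<omega> (c * dist x y)"
        using mod[OF z(1) xy(1)] moduli_mono[OF \<omega> _ z(2)] by simp
    qed auto
    then show ?thesis by (simp add: dist_norm norm_minus_commute)
  qed
  then have "successively (\<lambda>a b. \<bar>h b - h a\<bar> \<le> \<omega> (c * dist x y) * dist a b) ps"
    by (intro successively_mono[OF ps(6)]) auto
  from chain_lipschitz[OF ps(1) this]
  have "\<bar>h y - h x\<bar> \<le> \<omega> (c * dist x y) * chain_length ps"
    by (simp add: ps)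
  also have "\<dots> \<le> \<omega> (c * dist x y) * (c * dist x y)"
    using moduli_nonneg[OF \<omega> cd] ps(5) by (rule mult_left_mono[rotated])
  also have "h y - h x = f y - f x - f' x (y - x)"
    using linear_diff[OF bounded_linear.linear[OF lin], of y x] by (simp add: h_def)
  finally show ?thesis .
qed

section \<open>Extension from quasiconvex open sets\<close>

theorem corollary42:
  fixes U :: "'a::banach set" and \<omega> :: "real \<Rightarrow> real" and f :: "'a \<Rightarrow> real"
  assumes "super_reflexive TYPE('a)"
    and "\<exists>N :: 'a \<Rightarrow> real. equivalent_norm N \<and> smoothness_power_type N 2"
    and "open U" and "quasiconvex U"
    and "\<omega> \<in> moduli"
    and "f \<in> C1_omega \<omega> U"
  shows "\<exists>F \<in> C1_omega \<omega> UNIV. \<forall>x\<in>U. F x = f x"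
proof (cases "U = {}")
  case True
  have "(\<lambda>x. 0) \<in> C1_omega \<omega> UNIV"
    by (auto simp: C1_omega_def onorm_zero intro!: exI[of _ 0])
  with True show ?thesis by blast
next
  case False
  obtain N :: "'a \<Rightarrow> real" where N: "equivalent_norm N" "smoothness_power_type N 2"
    using assms(2) by blast
  obtain c where qc: "c_quasiconvex c U" using assms(4) by (auto simp: quasiconvex_def)
  then have c: "c \<ge> 1" by (simp add: c_quasiconvex_def)
  define G where "G x = frechet_derivative f (at x)" for x
  have der: "(f has_derivative G x) (at x)" if "x \<in> U" for x
    unfolding G_def using assms(6) that by (simp add: C1_omega_def flip: frechet_derivative_works)
  then have bl: "bounded_linear (G x)" if "x \<in> U" for x
    using that has_derivative_bounded_linear by blast
  obtain C where C: "C \<ge> 0"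
    "\<And>x y. x \<in> U \<Longrightarrow> y \<in> U \<Longrightarrow> onorm (\<lambda>h. G x h - G y h) \<le> C * \<omega> (dist x y)"
    using assms(6) by (auto simp: C1_omega_def G_def dist_norm)
  have bl_diff: "bounded_linear (\<lambda>h. G x h - G y h)" if "x \<in> U" "y \<in> U" for x y
    using bl that by (intro bounded_linear_sub)
  have tri: "onorm (\<lambda>h. G x h - G z h) \<le> onorm (\<lambda>h. G x h - G y h) + onorm (\<lambda>h. G y h - G z h)"
    if "x \<in> U" "y \<in> U" "z \<in> U" for x y z
    using onorm_triangle[OF bl_diff[OF that(1,2)] bl_diff[OF that(2,3)]] by simp
  have nonneg: "0 \<le> onorm (\<lambda>h. G x h - G y h)" if "x \<in> U" "y \<in> U" for x y
    using that by (intro onorm_pos_le bl_diff)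
  have "\<exists>\<omega>' K. concave_modulus \<omega>' \<and> K \<ge> 0 \<and> (\<forall>s\<ge>0. \<omega>' s \<le> K * \<omega> s) \<and>
      (\<forall>x\<in>U. \<forall>y\<in>U. onorm (\<lambda>h. G x h - G y h) \<le> \<omega>' (dist x y))"
    by (rule quasiconvex_concave_majorant[where D = "\<lambda>x y. onorm (\<lambda>h. G x h - G y h)",
          OF assms(3) qc False assms(5) C(1)]) (rule tri nonneg C(2), assumption+ | blast)+
  then obtain \<omega>' K where \<omega>': "concave_modulus \<omega>'" and K: "K \<ge> 0" "\<And>s. s \<ge> 0 \<Longrightarrow> \<omega>' s \<le> K * \<omega> s"
    and mod: "\<And>x y. x \<in> U \<Longrightarrow> y \<in> U \<Longrightarrow> onorm (\<lambda>h. G x h - G y h) \<le> \<omega>' (dist x y)"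
    by blast
  have \<omega>'m: "\<omega>' \<in> moduli" using \<omega>' by (simp add: concave_modulus_def)
  have "\<exists>F. F \<in> C1_omega \<omega>' UNIV \<and> (\<forall>x\<in>U. F x = f x)"
  proof (rule C1_omega_jet_extension[OF \<omega>' N False, of "c\<^sup>2" G f])
    fix x y h assume xy: "x \<in> U" "y \<in> U"
    have "\<bar>f y - f x - G x (y - x)\<bar> \<le> (c * dist x y) * \<omega>' (c * dist x y)"
      using quasiconvex_taylor[OF assms(3) qc \<omega>'m der mod xy] by (simp add: mult.commute)
    also have "\<dots> \<le> c\<^sup>2 * (dist x y * \<omega>' (dist x y))"
      by (rule modulus_times_id_mult_le[OF \<omega>' c zero_le_dist])
    finally show "\<bar>f y - f x - G x (y - x)\<bar> \<le> c\<^sup>2 * (norm (x - y) * \<omega>' (norm (x - y)))"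
      by (simp add: dist_norm)
    have "\<bar>G x h - G y h\<bar> \<le> onorm (\<lambda>h. G x h - G y h) * norm h"
      using onorm[OF bl_diff[OF xy], of h] by simp
    also have "\<dots> \<le> \<omega>' (dist x y) * norm h"
      by (intro mult_right_mono mod xy) simp
    also have "\<dots> \<le> (c\<^sup>2 * \<omega>' (dist x y)) * norm h"
      using c moduli_nonneg[OF \<omega>'m, of "dist x y"] mult_right_mono[of 1 "c\<^sup>2" "\<omega>' (dist x y)"]
      by (intro mult_right_mono) auto
    finally show "\<bar>G x h - G y h\<bar> \<le> c\<^sup>2 * \<omega>' (norm (x - y)) * norm h"
      by (simp add: dist_norm)
  qed (use bl in auto)
  then obtain F where F: "F \<in> C1_omega \<omega>' UNIV" "\<forall>x\<in>U. F x = f x" by blast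
  have "F \<in> C1_omega \<omega> UNIV"
  proof -
    obtain C' where C': "C' \<ge> 0" "\<And>x y. onorm (\<lambda>h. frechet_derivative F (at x) h - frechet_derivative F (at y) h)
        \<le> C' * \<omega>' (norm (x - y))"
      using F(1) by (auto simp: C1_omega_def)
    have "onorm (\<lambda>h. frechet_derivative F (at x) h - frechet_derivative F (at y) h)
        \<le> (C' * K) * \<omega> (norm (x - y))" for x y
      using order_trans[OF C'(2) mult_left_mono[OF K(2) C'(1)]] by (simp add: mult.assoc)
    moreover have "C' * K \<ge> 0" using C' K by simp
    ultimately show ?thesis
      using F(1) unfolding C1_omega_def by blast
  qed
  with F(2) show ?thesis by blast
qed

end
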